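(* Let $\mathcal H$ be a real separable Hilbert space, let $\widetilde{\mathcal H}=\mathcal H\oplus\mathcal H$, and let $A$ be a bounded positive invertible operator on $\widetilde{\mathcal H}$. Then: (i) $W_s(A)=W_s(MAM^T)$ for every symplectic transformation $M$ of $\widetilde{\mathcal H}$. (ii) $\sigma_s(A)\subseteq\overline{W_s(A)}=[\inf\sigma_s(A),\infty)$. (iii) If $\mathcal H$ is finite-dimensional, then $W_s(A)$ is the closed set $[d_1(A),\infty)$, where $d_1(A)$ is the minimum symplectic eigenvalue of $A$.
   Context: On $\widetilde{\mathcal H}=\mathcal H\oplus\mathcal H$ let $J=\begin{bmatrix}0&I\\-I&0\end{bmatrix}$. A symplectic transformation of $\widetilde{\mathcal H}$ is a bounded invertible linear operator $M$ with $M^TJM=J$. An operator is positive invertible if it is self-adjoint, $\langle x,Ax\rangle>0$ for all $x\ne0$, and it is invertible (with bounded inverse). The symplectic numerical range of a positive definite operator $A$ on $\widetilde{\mathcal H}$ is $$W_s(A)=\left\{\tfrac12\big(\langle u,Au\rangle+\langle v,Av\rangle\big): u,v\in\widetilde{\mathcal H},\ \langle u,Jv\rangle=1\right\}.$$ By the (infinite-dimensional) Williamson theorem, for every bounded positive invertible operator $A$ on $\widetilde{\mathcal H}$ there are a positive invertible operator $P$ on $\mathcal H$ and a symplectic transformation $L$ of $\widetilde{\mathcal H}$ with $A=L\begin{bmatrix}P&0\\0&P\end{bmatrix}L^T$; the symplectic spectrum $\sigma_s(A)$ is the spectrum of $P$ (it depends only on $A$). If $\dim\mathcal H=n<\infty$,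 $\sigma_s(A)=\{d_1(A),\dots,d_n(A)\}$ is the set of symplectic eigenvalues $d_1(A)\le\dots\le d_n(A)$ of $A$. *)

theory Defs
  imports "HOL-Analysis.Analysis"
begin

text \<open>
  Operators on a real Hilbert space are plain functions subject to \<^const>\<open>bounded_linear\<close>; the
  transpose is \<^const>\<open>adjoint\<close>. The direct sum of two copies of the Hilbert space is the product
  type with its library inner product.
\<close>

definition bounded_invertible :: "('a::real_normed_vector \<Rightarrow> 'a) \<Rightarrow> bool" where
  "bounded_invertible T \<longleftrightarrow>
     bounded_linear T \<and> (\<exists>S. bounded_linear S \<and> S \<circ> T = id \<and> T \<circ> S = id)"

definition positive_invertible :: "('a::real_inner \<Rightarrow> 'a) \<Rightarrow> bool" where
  "positive_invertible A \<longleftrightarrow>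
     bounded_linear A \<and> adjoint A = A \<and> (\<forall>x. x \<noteq> 0 \<longrightarrow> x \<bullet> A x > 0) \<and> bounded_invertible A"

text \<open>
  Only real spectral values are considered. For a self-adjoint operator on a real Hilbert space,
  the only kind it is applied to below, this is also the spectrum of the complexification.
\<close>

definition spectrum :: "('a::real_normed_vector \<Rightarrow> 'a) \<Rightarrow> real set" where
  "spectrum T = {c. \<not> bounded_invertible (\<lambda>x. T x - c *\<^sub>R x)}"

definition J_op :: "'a::real_inner \<times> 'a \<Rightarrow> 'a \<times> 'a" where
  "J_op = (\<lambda>(x, y). (y, - x))"

definition symplectic :: "('a::real_inner \<times> 'a \<Rightarrow> 'a \<times> 'a) \<Rightarrow> bool" where
  "symplectic M \<longleftrightarrow> bounded_invertible M \<and> adjoint M \<circ> J_op \<circ> M = J_op"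

definition symplectic_numerical_range :: "('a::real_inner \<times> 'a \<Rightarrow> 'a \<times> 'a) \<Rightarrow> real set" where
  "symplectic_numerical_range A = {(u \<bullet> A u + v \<bullet> A v) / 2 | u v. u \<bullet> J_op v = 1}"

definition williamson_form ::
  "('a::real_inner \<times> 'a \<Rightarrow> 'a \<times> 'a) \<Rightarrow> ('a \<Rightarrow> 'a) \<Rightarrow> ('a \<times> 'a \<Rightarrow> 'a \<times> 'a) \<Rightarrow> bool" where
  "williamson_form A P L \<longleftrightarrow>
     positive_invertible P \<and> symplectic L \<and> A = L \<circ> map_prod P P \<circ> adjoint L"

text \<open>
  The definite description is meaningful for positive invertible \<open>A\<close> on the double of a separable
  real Hilbert space: Williamson's theorem provides a \<^const>\<open>williamson_form\<close>, and the spectrum of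
  \<open>P\<close> does not depend on which one is taken.
\<close>

definition symplectic_spectrum :: "('a::real_inner \<times> 'a \<Rightarrow> 'a \<times> 'a) \<Rightarrow> real set" where
  "symplectic_spectrum A = (THE S. \<exists>P L. williamson_form A P L \<and> S = spectrum P)"

text \<open>
  For a nonzero finite-dimensional space the symplectic spectrum is the finite nonempty set of
  symplectic eigenvalues, so \<^const>\<open>Min\<close> is their minimum.
\<close>

definition min_symplectic_eigenvalue :: "('a::real_inner \<times> 'a \<Rightarrow> 'a \<times> 'a) \<Rightarrow> real" where
  "min_symplectic_eigenvalue A = Min (symplectic_spectrum A)"

end

(*
  Write A = L (P (+) P) L^T by Williamson's theorem.  It is proved by taking R = sqrt A and the polar
  decomposition R J R = U C of a skew operator: U is a complex structure commuting with C, and a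
  maximal C-invariant Lagrangian subspace for U splits the space into two copies on which C acts
  in the same way.  As (A J)^2 is similar to -(P (+) P)^2, the spectrum of P depends on A only.

  Congruence by a symplectic transformation does not change the numerical range, so A may be
  replaced by P (+) P.  If m is the bottom of the spectrum of P, then 2 <u, J v> <= |u|^2 + |v|^2
  gives the lower bound m, and (a x, 0), (0, b x) with x a unit vector, <x, P x> close to m and
  a b = 1 realise every value above m.  In finite dimension an eigenvector for m realises m too.
*)

theory Submission
  imports Defs
begin

text \<open>No spectral theorem is used. Positivity together with invertibility is turned into a
  uniform bound \<open>e * (x \<bullet> x) \<le> x \<bullet> T x\<close>. After scaling, the
  operator is the identity minus a strict contraction, so inverses and square roots arise from
  geometrically convergent iterations. The Lagrangian subspace is maximal not for plain isotropy but
  for the relation "x is orthogonal to U C^n y for all n". The powers of C build the invariance into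
  the relation, and every vector is related to itself because U C^n is skew. The remaining obstacle
  is that P must act on the given space, while C acts on a Lagrangian subspace S of its double.
  Transporting C needs an isometry from the space onto S, hence orthonormal bases of equal
  cardinality. Doubling either basis gives an orthonormal basis of the same double space, which
  settles the finite case. In the infinite case both bases are countable, and this is where
  separability enters.\<close>

section \<open>Orthogonal projection, Riesz representation and adjoints\<close>

text \<open>Moving \<open>s\<close> by \<open>r *\<^sub>R t\<close>, the component of
  \<open>x - s\<close> along \<open>t\<close>, would lower the squared distance by
  \<open>r * r * (t \<bullet> t)\<close>; minimality forces \<open>r = 0\<close>.\<close>

lemma closest_point_orthogonal:
  fixes x :: "'a::real_inner"
  assumes S: "subspace S" and s: "s \<in> S" and min: "\<And>t. t \<in> S \<Longrightarrow> (x - s) \<bullet> (x - s) \<le> (x - t) \<bullet> (x - t)"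
    and t: "t \<in> S"
  shows "(x - s) \<bullet> t = 0"
proof (cases "t = 0")
  case False
  define r where "r = ((x - s) \<bullet> t) / (t \<bullet> t)"
  have tt: "t \<bullet> t > 0" using False by simp
  have "s + r *\<^sub>R t \<in> S" using S s t by (simp add: subspace_add subspace_scale)
  then have "(x - s) \<bullet> (x - s) \<le> ((x - s) - r *\<^sub>R t) \<bullet> ((x - s) - r *\<^sub>R t)"
    using min by (metis diff_diff_eq)
  also have "\<dots> = (x - s) \<bullet> (x - s) - 2 * r * ((x - s) \<bullet> t) + r * r * (t \<bullet> t)"
    by (simp add: inner_diff_left inner_diff_right inner_commute algebra_simps)
  finally have "2 * r * ((x - s) \<bullet> t) \<le> r * r * (t \<bullet> t)" by simp
  moreover have "(x - s) \<bullet> t = r * (t \<bullet> t)" using tt by (simp add: r_def)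
  ultimately have "r * r * (t \<bullet> t) \<le> 0" by simp
  then have "r = 0" using tt by (metis mult_le_0_iff not_le not_real_square_gt_zero zero_less_mult_iff)
  then show ?thesis using tt by (simp add: r_def)
qed simp

text \<open>A sequence in \<open>S\<close> that minimises the distance to \<open>x\<close> is Cauchy
  by the parallelogram law; its limit is the closest point.\<close>

lemma exists_orthogonal_projection:
  fixes S :: "'a::{real_inner, complete_space} set"
  assumes S: "subspace S" "closed S"
  obtains s where "s \<in> S" "\<And>t. t \<in> S \<Longrightarrow> (x - s) \<bullet> t = 0"
proof -
  define q where "q s = (x - s) \<bullet> (x - s)" for s
  define d where "d = Inf (q ` S)"
  have ne: "S \<noteq> {}" using S(1) subspace_0 by blast
  have bdd: "bdd_below (q ` S)" by (rule bdd_belowI[of _ 0]) (auto simp: q_def)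
  have dle: "d \<le> q t" if "t \<in> S" for t
    unfolding d_def using bdd that by (simp add: cINF_lower)
  have "\<exists>s\<in>S. q s < d + 1 / Suc n" for n :: nat
    unfolding d_def using cInf_lessD[of "q ` S" "Inf (q ` S) + 1 / Suc n"] ne by auto
  then obtain s where s: "\<And>n. s n \<in> S" and qs: "\<And>n::nat. q (s n) < d + 1 / Suc n" by metis
  \<comment> \<open>Parallelogram identity: the midpoint lies in \<open>S\<close>, so its squared
    distance to \<open>x\<close> is at least \<open>d\<close>, and the terms in \<open>d\<close>
    cancel.\<close>
  have par: "(s m - s n) \<bullet> (s m - s n) \<le> 4 / Suc N" if "m \<ge> N" "n \<ge> N" for m n N :: nat
  proof -
    have "(s m - s n) \<bullet> (s m - s n) = 2 * q (s m) + 2 * q (s n) - 4 * q ((1/2) *\<^sub>R (s m + s n))"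
      unfolding q_def by (simp add: inner_diff_left inner_diff_right inner_add_left inner_add_right
        inner_commute algebra_simps)
    moreover have "d \<le> q ((1/2) *\<^sub>R (s m + s n))"
      using S(1) s by (intro dle) (simp add: subspace_add subspace_scale)
    moreover have "1 / Suc m \<le> 1 / Suc N" "1 / Suc n \<le> 1 / Suc N"
      using that by (simp_all add: frac_le)
    ultimately show ?thesis using qs[of m] qs[of n] by linarith
  qed
  have "Cauchy s"
  proof (rule metric_CauchyI)
    fix e :: real assume e: "e > 0"
    obtain N :: nat where N: "4 / e\<^sup>2 < N" using reals_Archimedean2 by blast
    have "dist (s m) (s n) < e" if "m \<ge> N" "n \<ge> N" for m n
    proof -
      have "4 / Suc N < e\<^sup>2"
        using N e by (simp add: field_simps) (smt (verit) zero_less_power)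
      then have "(dist (s m) (s n))\<^sup>2 < e\<^sup>2"
        using par[OF that] by (simp add: dist_norm power2_norm_eq_inner)
      then show ?thesis using e by (simp add: power_less_imp_less_base)
    qed
    then show "\<exists>M. \<forall>m\<ge>M. \<forall>n\<ge>M. dist (s m) (s n) < e" by blast
  qed
  then obtain p where p: "s \<longlonglongrightarrow> p" using Cauchy_convergent convergent_def by blast
  have pS: "p \<in> S" using closed_sequentially[OF S(2)] s p by blast
  have lim1: "(\<lambda>n. q (s n)) \<longlonglongrightarrow> q p" unfolding q_def by (intro tendsto_intros p)
  have lim2: "(\<lambda>n. d + 1 / Suc n) \<longlonglongrightarrow> d + 0"
    by (intro tendsto_intros LIMSEQ_Suc lim_1_over_n)
  have "q p \<le> d + 0" by (rule LIMSEQ_le[OF lim1 lim2]) (use qs less_imp_le in blast)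
  have "(x - p) \<bullet> t = 0" if "t \<in> S" for t
  proof (rule closest_point_orthogonal[OF S(1) pS _ that])
    show "(x - p) \<bullet> (x - p) \<le> (x - t) \<bullet> (x - t)" if "t \<in> S" for t
      using \<open>q p \<le> d + 0\<close> dle[OF that] unfolding q_def by linarith
  qed
  with pS show thesis by (rule that)
qed

text \<open>The kernel has codimension one, so a vector \<open>e\<close> orthogonal to it determines
  \<open>f\<close> up to a factor: \<open>x - (f x / f e) *\<^sub>R e\<close> always lies in the
  kernel.\<close>

lemma riesz_representation:
  fixes f :: "'a::{real_inner, complete_space} \<Rightarrow> real"
  assumes f: "bounded_linear f"
  shows "\<exists>w. \<forall>x. f x = x \<bullet> w"
proof (cases "\<exists>z. f z \<noteq> 0")
  case True
  then obtain z where z: "f z \<noteq> 0" by blast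
  interpret bounded_linear f by fact
  have "subspace {x. f x = 0}" by (simp add: subspace_def add scaleR zero)
  moreover have "closed {x. f x = 0}"
    by (intro closed_Collect_eq continuous_on continuous_on_id continuous_on_const)
  ultimately obtain s where s: "f s = 0" "\<And>t. f t = 0 \<Longrightarrow> (z - s) \<bullet> t = 0"
    using exists_orthogonal_projection[of "{x. f x = 0}" z] by auto
  define e where "e = z - s"
  have fe: "f e \<noteq> 0" using z s by (simp add: e_def diff)
  then have ee: "e \<bullet> e \<noteq> 0" using zero by auto
  have "f x = x \<bullet> ((f e / (e \<bullet> e)) *\<^sub>R e)" for x
  proof -
    have "f (x - (f x / f e) *\<^sub>R e) = 0" using fe by (simp add: diff scaleR)
    then have "e \<bullet> (x - (f x / f e) *\<^sub>R e) = 0" using s(2) by (simp add: e_def)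
    then show ?thesis using fe ee by (simp add: inner_diff_right inner_commute field_simps)
  qed
  then show ?thesis by blast
qed (auto intro!: exI[of _ 0])

text \<open>\<open>adjoint\<close> is specified by choice, so its defining identity holds only once
  some transpose exists; Riesz representation of \<open>f x \<bullet> y\<close> as a functional of
  \<open>x\<close> supplies one.\<close>

lemma inner_adjoint:
  fixes f :: "'a::{real_inner, complete_space} \<Rightarrow> 'b::real_inner"
  assumes f: "bounded_linear f"
  shows "f x \<bullet> y = x \<bullet> adjoint f y"
proof -
  have "\<exists>w. \<forall>x. f x \<bullet> y = x \<bullet> w" for y
    by (rule riesz_representation) (rule bounded_linear_compose[OF bounded_linear_inner_left f])
  then obtain g where g: "\<forall>x y. f x \<bullet> y = x \<bullet> g y" by metis
  show ?thesis using g adjoint_unique[OF g] by simp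
qed

lemma bounded_linear_adjoint:
  fixes f :: "'a::{real_inner, complete_space} \<Rightarrow> 'b::real_inner"
  assumes f: "bounded_linear f"
  shows "bounded_linear (adjoint f)"
proof -
  note a = inner_adjoint[OF f, symmetric]
  obtain K where K0: "0 \<le> K" and K: "\<And>x. norm (f x) \<le> norm x * K"
    using bounded_linear.nonneg_bounded[OF f] by blast
  show ?thesis
  proof (rule bounded_linear_intro[where K = K])
    show "adjoint f (x + y) = adjoint f x + adjoint f y" for x y
      by (subst vector_eq_ldot[symmetric]) (simp add: a inner_add_right)
    show "adjoint f (r *\<^sub>R x) = r *\<^sub>R adjoint f x" for r x
      by (subst vector_eq_ldot[symmetric]) (simp add: a)
    show "norm (adjoint f x) \<le> norm x * K" for x
    proof (cases "adjoint f x = 0")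
      case True
      then show ?thesis using K0 by simp
    next
      case False
      have "norm (adjoint f x) * norm (adjoint f x) = f (adjoint f x) \<bullet> x"
        by (simp add: a[symmetric] power2_norm_eq_inner flip: power2_eq_square)
      also have "\<dots> \<le> norm (f (adjoint f x)) * norm x" by (rule norm_cauchy_schwarz)
      also have "\<dots> \<le> norm (adjoint f x) * K * norm x" by (simp add: K mult_right_mono)
      finally show ?thesis using False by (simp add: algebra_simps)
    qed
  qed
qed

section \<open>Symmetric operators with a nonnegative form\<close>

text \<open>A pointwise identity, in contrast to \<open>adjoint T = T\<close>, presupposes no
  transpose and passes directly to sums, compositions of an operator with itself and limits.\<close>

definition symmetric_operator :: "('a::real_inner \<Rightarrow> 'a) \<Rightarrow> bool" where
  "symmetric_operator T \<longleftrightarrow> (\<forall>x y. T x \<bullet> y = x \<bullet> T y)"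

lemma symmetric_operatorD: "symmetric_operator T \<Longrightarrow> T x \<bullet> y = x \<bullet> T y"
  by (simp add: symmetric_operator_def)

text \<open>The form at \<open>x + t *\<^sub>R y\<close> is a nonnegative quadratic polynomial in
  \<open>t\<close>, evaluated at its minimiser \<open>- b / c\<close>. The form may be degenerate,
  so \<open>c = 0\<close> is treated apart.\<close>

lemma form_cauchy_schwarz:
  fixes T :: "'a::real_inner \<Rightarrow> 'a"
  assumes T: "linear T" "symmetric_operator T" and nonneg: "\<And>x. 0 \<le> x \<bullet> T x"
  shows "(x \<bullet> T y)\<^sup>2 \<le> (x \<bullet> T x) * (y \<bullet> T y)"
proof -
  define a b c where "a = x \<bullet> T x" and "b = x \<bullet> T y" and "c = y \<bullet> T y"
  have yx: "y \<bullet> T x = b"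
    using symmetric_operatorD[OF T(2)] by (metis b_def inner_commute)
  have q: "0 \<le> a + 2 * t * b + t * t * c" for t
  proof -
    have "0 \<le> (x + t *\<^sub>R y) \<bullet> T (x + t *\<^sub>R y)" by (rule nonneg)
    also have "\<dots> = a + 2 * t * b + t * t * c"
      by (simp add: linear_add[OF T(1)] linear_scale[OF T(1)] inner_add_left inner_add_right yx
        flip: a_def b_def c_def) (simp add: algebra_simps)
    finally show ?thesis .
  qed
  have "b\<^sup>2 \<le> a * c"
  proof (cases "c = 0")
    case True
    show ?thesis
    proof (cases "b = 0")
      case False
      \<comment> \<open>For \<open>c = 0\<close> the polynomial is affine, and at this
        \<open>t\<close> it would equal -1.\<close>
      with q[of "- (a + 1) / (2 * b)"] True show ?thesis by (simp add: field_simps)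
    qed (simp add: True)
  next
    case False
    then have "c > 0" using nonneg[of y] by (simp add: c_def)
    then show ?thesis using q[of "- b / c"] by (simp add: field_simps power2_eq_square)
  qed
  then show ?thesis by (simp add: a_def b_def c_def)
qed

text \<open>In operator terms, T <= q gives T^2 <= q T: apply the Cauchy-Schwarz inequality of the
  form to the vectors \<open>T x\<close> and \<open>x\<close>, then cancel
  \<open>T x \<bullet> T x\<close>.\<close>

lemma inner_image_le:
  fixes T :: "'a::real_inner \<Rightarrow> 'a"
  assumes T: "linear T" "symmetric_operator T" and nonneg: "\<And>x. 0 \<le> x \<bullet> T x"
    and q: "\<And>x. x \<bullet> T x \<le> q * (x \<bullet> x)"
  shows "T x \<bullet> T x \<le> q * (x \<bullet> T x)"
proof (cases "T x = 0")
  case False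
  then have p: "T x \<bullet> T x > 0" by simp
  have "(T x \<bullet> T x)\<^sup>2 \<le> (T x \<bullet> T (T x)) * (x \<bullet> T x)"
    by (rule form_cauchy_schwarz[OF T nonneg])
  also have "\<dots> \<le> (q * (T x \<bullet> T x)) * (x \<bullet> T x)"
    by (rule mult_right_mono[OF q nonneg])
  finally have "(T x \<bullet> T x) * (T x \<bullet> T x) \<le> (T x \<bullet> T x) * (q * (x \<bullet> T x))"
    by (simp add: power2_eq_square ac_simps)
  then show ?thesis using p by (simp only: mult_le_cancel_left_pos)
qed simp

text \<open>The chain T^2 <= q T <= q^2 converts a bound on the quadratic form into a bound on the
  operator norm.\<close>

lemma norm_le_of_form_le:
  fixes T :: "'a::real_inner \<Rightarrow> 'a"
  assumes T: "linear T" "symmetric_operator T" and nonneg: "\<And>x. 0 \<le> x \<bullet> T x"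
    and q: "\<And>x. x \<bullet> T x \<le> q * (x \<bullet> x)" and q0: "0 \<le> q"
  shows "norm (T x) \<le> q * norm x"
proof -
  have "T x \<bullet> T x \<le> q * (x \<bullet> T x)" by (rule inner_image_le[OF T nonneg q])
  also have "\<dots> \<le> q * (q * (x \<bullet> x))" by (rule mult_left_mono[OF q q0])
  finally have "(norm (T x))\<^sup>2 \<le> (q * norm x)\<^sup>2"
    by (simp add: power2_norm_eq_inner power_mult_distrib power2_eq_square[of q] ac_simps)
  then show ?thesis using q0 by (meson power2_le_imp_le mult_nonneg_nonneg norm_ge_zero)
qed

section \<open>Bounded invertibility and coercivity\<close>

lemma bounded_invertibleI:
  assumes T: "bounded_linear T" "surj T" and e: "e > 0" "\<And>x. e * norm x \<le> norm (T x)"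
  shows "bounded_invertible T"
proof -
  interpret bounded_linear T by fact
  have inj: "inj T"
  proof (rule injI)
    fix x y assume "T x = T y"
    then have "e * norm (x - y) \<le> 0" using e(2)[of "x - y"] by (simp add: diff)
    then show "x = y" using e(1) by (simp add: mult_le_0_iff)
  qed
  have TS: "T (inv T y) = y" for y using T(2) by (simp add: surj_f_inv_f)
  have "bounded_linear (inv T)"
  proof (rule bounded_linear_intro[where K = "1 / e"])
    show "inv T (x + y) = inv T x + inv T y" for x y
      by (rule inv_f_eq[OF inj]) (simp add: add TS)
    show "inv T (r *\<^sub>R x) = r *\<^sub>R inv T x" for r x
      by (rule inv_f_eq[OF inj]) (simp add: scaleR TS)
    show "norm (inv T x) \<le> norm x * (1 / e)" for x
      using e(2)[of "inv T x"] e(1) by (simp add: TS field_simps)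
  qed
  then show ?thesis unfolding bounded_invertible_def
    by (intro conjI T exI[of _ "inv T"]) (simp_all add: inj TS fun_eq_iff)
qed

lemma bounded_invertibleE:
  assumes "bounded_invertible T"
  obtains S where "bounded_linear T" "bounded_linear S" "\<And>x. S (T x) = x" "\<And>x. T (S x) = x"
  using assms unfolding bounded_invertible_def by (metis comp_apply id_apply)

lemma bounded_invertibleI_inverse:
  assumes "bounded_linear T" "bounded_linear S" "\<And>x. S (T x) = x" "\<And>x. T (S x) = x"
  shows "bounded_invertible T"
  unfolding bounded_invertible_def using assms by (intro conjI exI[of _ S]) (auto simp: fun_eq_iff)

lemma bounded_invertible_comp:
  assumes "bounded_invertible T" "bounded_invertible S"
  shows "bounded_invertible (\<lambda>x. T (S x))"
proof -
  obtain T' where T: "bounded_linear T" "bounded_linear T'" "\<And>x. T' (T x) = x" "\<And>x. T (T' x) = x"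
    by (rule bounded_invertibleE[OF assms(1)]) blast
  obtain S' where S: "bounded_linear S" "bounded_linear S'" "\<And>x. S' (S x) = x" "\<And>x. S (S' x) = x"
    by (rule bounded_invertibleE[OF assms(2)]) blast
  show ?thesis
    by (rule bounded_invertibleI_inverse[where S = "\<lambda>x. S' (T' x)"])
      (simp_all add: T S bounded_linear_compose)
qed

lemma bounded_invertible_scaleR:
  fixes T :: "'a::real_normed_vector \<Rightarrow> 'a"
  assumes "bounded_invertible T" "c \<noteq> 0"
  shows "bounded_invertible (\<lambda>x. c *\<^sub>R T x)"
proof -
  have "bounded_invertible (\<lambda>x::'a. c *\<^sub>R x)"
    by (rule bounded_invertibleI_inverse[where S = "\<lambda>x. (1 / c) *\<^sub>R x"])
      (use assms(2) in \<open>simp_all add: bounded_linear_scaleR_right\<close>)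
  from bounded_invertible_comp[OF this assms(1)] show ?thesis .
qed

text \<open>Solving \<open>x - T x = y\<close> is finding the fixed point of the contraction that
  maps \<open>x\<close> to \<open>y + T x\<close>.\<close>

lemma bounded_invertible_id_minus:
  fixes T :: "'a::{real_normed_vector, complete_space} \<Rightarrow> 'a"
  assumes T: "bounded_linear T" and q: "0 \<le> q" "q < 1" "\<And>x. norm (T x) \<le> q * norm x"
  shows "bounded_invertible (\<lambda>x. x - T x)"
proof (rule bounded_invertibleI)
  interpret bounded_linear T by fact
  show "bounded_linear (\<lambda>x. x - T x)" by (intro bounded_linear_sub bounded_linear_ident T)
  show "surj (\<lambda>x. x - T x)"
  proof (rule surjI)
    fix y
    have "\<forall>x z. dist (y + T x) (y + T z) \<le> q * dist x z"
      using q(3) by (simp add: dist_norm flip: diff)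
    then have "\<exists>!x. y + T x = x" by (rule banach_fix_type[OF q(1,2)])
    then have "y + T (THE x. y + T x = x) = (THE x. y + T x = x)" by (rule theI')
    then show "(THE x. y + T x = x) - T (THE x. y + T x = x) = y" by (simp add: algebra_simps)
  qed
  show "1 - q > 0" using q by simp
  show "(1 - q) * norm x \<le> norm (x - T x)" for x
    using norm_triangle_ineq2[of x "T x"] q(3)[of x] by (simp add: algebra_simps)
qed

lemma bounded_linear_form_bound:
  assumes "bounded_linear T"
  obtains c where "c > 0" "\<And>x. x \<bullet> T x \<le> c * (x \<bullet> x)"
proof -
  obtain K where K: "K > 0" "\<And>x. norm (T x) \<le> norm x * K"
    using bounded_linear.pos_bounded[OF assms] by blast
  have "x \<bullet> T x \<le> K * (x \<bullet> x)" for x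
  proof -
    have "x \<bullet> T x \<le> norm x * norm (T x)" by (rule norm_cauchy_schwarz)
    also have "\<dots> \<le> norm x * (norm x * K)" by (intro mult_left_mono K) simp
    finally show ?thesis by (simp add: dot_square_norm power2_eq_square ac_simps)
  qed
  with K(1) show thesis by (rule that)
qed

text \<open>A coercive operator, divided by a large constant, is the identity minus a strict contraction.\<close>

lemma coercive_contraction:
  fixes T :: "'a::real_inner \<Rightarrow> 'a"
  assumes T: "bounded_linear T" "symmetric_operator T" and e: "e > 0" "\<And>x. e * (x \<bullet> x) \<le> x \<bullet> T x"
  obtains c q where "c > 0" "0 \<le> q" "q < 1" "\<And>x. norm (x - (1 / c) *\<^sub>R T x) \<le> q * norm x"
    "bounded_linear (\<lambda>x. x - (1 / c) *\<^sub>R T x)" "symmetric_operator (\<lambda>x. x - (1 / c) *\<^sub>R T x)"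
proof -
  obtain c0 where c0: "c0 > 0" "\<And>x. x \<bullet> T x \<le> c0 * (x \<bullet> x)" by (rule bounded_linear_form_bound[OF T(1)]) blast
  \<comment> \<open>Including \<open>e\<close> keeps \<open>1 - e / c\<close> nonnegative even on
    the zero space, where \<open>c0\<close> may be smaller than \<open>e\<close>.\<close>
  define c where "c = max c0 e"
  have c: "c > 0" "e \<le> c" using c0 by (auto simp: c_def)
  have cb: "x \<bullet> T x \<le> c * (x \<bullet> x)" for x
    using c0(2)[of x] mult_right_mono[of c0 c "x \<bullet> x"] by (simp add: c_def)
  define N where "N = (\<lambda>x. x - (1 / c) *\<^sub>R T x)"
  have N: "bounded_linear N"
    unfolding N_def by (intro bounded_linear_sub bounded_linear_ident bounded_linear_scaleR_right
      bounded_linear_compose[OF bounded_linear_scaleR_right] T)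
  have Ns: "symmetric_operator N"
    using T(2) by (simp add: symmetric_operator_def N_def inner_diff_left inner_diff_right)
  have form: "x \<bullet> N x = x \<bullet> x - (x \<bullet> T x) / c" for x by (simp add: N_def inner_diff_right)
  have "norm (N x) \<le> (1 - e / c) * norm x" for x
  proof (rule norm_le_of_form_le[OF bounded_linear.linear[OF N] Ns])
    show "0 \<le> x \<bullet> N x" for x using cb[of x] c by (simp add: form field_simps)
    show "x \<bullet> N x \<le> (1 - e / c) * (x \<bullet> x)" for x
      using e(2)[of x] c by (simp add: form field_simps)
    show "0 \<le> 1 - e / c" using c by simp
  qed
  then show thesis using c e N Ns that[of c "1 - e / c"] by (simp add: N_def)
qed

lemma coercive_bounded_invertible:
  fixes T :: "'a::{real_inner, complete_space} \<Rightarrow> 'a"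
  assumes T: "bounded_linear T" "symmetric_operator T" and e: "e > 0" "\<And>x. e * (x \<bullet> x) \<le> x \<bullet> T x"
  shows "bounded_invertible T"
proof -
  obtain c q where c: "c > 0" "0 \<le> q" "q < 1" "\<And>x. norm (x - (1 / c) *\<^sub>R T x) \<le> q * norm x"
    "bounded_linear (\<lambda>x. x - (1 / c) *\<^sub>R T x)" "symmetric_operator (\<lambda>x. x - (1 / c) *\<^sub>R T x)"
    by (rule coercive_contraction[OF T e]) blast
  have "bounded_invertible (\<lambda>x. c *\<^sub>R (x - (x - (1 / c) *\<^sub>R T x)))"
    using c by (intro bounded_invertible_scaleR bounded_invertible_id_minus[where q = q]) auto
  then show ?thesis using c(1) by simp
qed

text \<open>Converse of \<open>coercive_bounded_invertible\<close> for nonnegative forms: a bounded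
  inverse gives |x|^2 <= K^2 |T x|^2, and \<open>inner_image_le\<close> bounds |T x|^2 by a multiple
  of the form. This turns the pointwise positivity in \<open>positive_invertible\<close> into a
  uniform bound.\<close>

lemma invertible_nonneg_coercive:
  fixes T :: "'a::real_inner \<Rightarrow> 'a"
  assumes T: "bounded_invertible T" "symmetric_operator T" and nonneg: "\<And>x. 0 \<le> x \<bullet> T x"
  obtains e where "e > 0" "\<And>x. e * (x \<bullet> x) \<le> x \<bullet> T x"
proof -
  obtain S where S: "bounded_linear T" "bounded_linear S" "\<And>x. S (T x) = x"
    using bounded_invertibleE[OF T(1)] by metis
  obtain K where K: "K > 0" "\<And>x. norm (S x) \<le> norm x * K"
    using bounded_linear.pos_bounded[OF S(2)] by blast
  obtain c where c: "c > 0" "\<And>x. x \<bullet> T x \<le> c * (x \<bullet> x)" by (rule bounded_linear_form_bound[OF S(1)]) blast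
  have "1 / (K\<^sup>2 * c) * (x \<bullet> x) \<le> x \<bullet> T x" for x
  proof -
    have "x \<bullet> x = (norm (S (T x)))\<^sup>2" by (simp add: S(3) power2_norm_eq_inner)
    also have "\<dots> \<le> (norm (T x) * K)\<^sup>2" by (rule power_mono[OF K(2)]) simp
    also have "\<dots> = K\<^sup>2 * (T x \<bullet> T x)" by (simp add: power_mult_distrib power2_norm_eq_inner)
    also have "\<dots> \<le> K\<^sup>2 * (c * (x \<bullet> T x))"
      by (intro mult_left_mono inner_image_le[OF bounded_linear.linear[OF S(1)] T(2) nonneg c(2)]) simp
    finally show ?thesis using K c by (simp add: field_simps)
  qed
  with K c that[of "1 / (K\<^sup>2 * c)"] show thesis by simp
qed

lemma positive_invertibleI:
  fixes T :: "'a::{real_inner, complete_space} \<Rightarrow> 'a"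
  assumes T: "bounded_linear T" "symmetric_operator T" and e: "e > 0" "\<And>x. e * (x \<bullet> x) \<le> x \<bullet> T x"
  shows "positive_invertible T"
  unfolding positive_invertible_def
proof (intro conjI allI impI)
  show "adjoint T = T" using T(2) by (intro adjoint_unique) (simp add: symmetric_operator_def)
  show "x \<bullet> T x > 0" if "x \<noteq> 0" for x
  proof -
    have "0 < e * (x \<bullet> x)" using e(1) that by simp
    then show ?thesis using e(2)[of x] by simp
  qed
  show "bounded_invertible T" by (rule coercive_bounded_invertible[OF T e])
qed (rule T)

lemma positive_invertible_symmetric:
  fixes T :: "'a::{real_inner, complete_space} \<Rightarrow> 'a"
  assumes "positive_invertible T"
  shows "symmetric_operator T"
  using assms inner_adjoint[of T] by (simp add: positive_invertible_def symmetric_operator_def)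

lemma positive_invertible_bounded_linear: "positive_invertible T \<Longrightarrow> bounded_linear T"
  by (simp add: positive_invertible_def)

lemma positive_invertible_form_nonneg:
  assumes "positive_invertible T"
  shows "0 \<le> x \<bullet> T x"
  using assms by (cases "x = 0") (auto simp: positive_invertible_def intro: less_imp_le)

lemma positive_invertible_coercive:
  fixes T :: "'a::{real_inner, complete_space} \<Rightarrow> 'a"
  assumes T: "positive_invertible T"
  obtains e where "e > 0" "\<And>x. e * (x \<bullet> x) \<le> x \<bullet> T x"
  using invertible_nonneg_coercive[OF _ positive_invertible_symmetric[OF T]
    positive_invertible_form_nonneg[OF T]] T
  unfolding positive_invertible_def by metis

lemma positive_invertible_inverse:
  fixes T :: "'a::{real_inner, complete_space} \<Rightarrow> 'a"
  assumes T: "positive_invertible T"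
  obtains S where "positive_invertible S" "\<And>x. S (T x) = x" "\<And>x. T (S x) = x"
proof -
  note s = positive_invertible_symmetric[OF T]
  obtain S where S: "bounded_linear T" "bounded_linear S" "\<And>x. S (T x) = x" "\<And>x. T (S x) = x"
    using bounded_invertibleE T unfolding positive_invertible_def by metis
  have sS: "symmetric_operator S"
    unfolding symmetric_operator_def by (metis S(4) s symmetric_operatorD)
  have nS: "0 \<le> x \<bullet> S x" for x
    using positive_invertible_form_nonneg[OF T, of "S x"] by (simp add: S inner_commute)
  obtain e where "e > 0" "\<And>x. e * (x \<bullet> x) \<le> x \<bullet> S x"
    by (rule invertible_nonneg_coercive[OF bounded_invertibleI_inverse[OF S(2,1,4,3)] sS nS]) blast
  then show thesis using that positive_invertibleI[OF S(2) sS] S by blast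
qed

section \<open>Square roots of positive invertible operators\<close>

lemma Cauchy_of_geometric_steps:
  fixes f :: "nat \<Rightarrow> 'a::metric_space"
  assumes q: "0 \<le> q" "q < 1" and step: "\<And>n. dist (f (Suc n)) (f n) \<le> c * q ^ n"
  shows "Cauchy f"
proof -
  have c: "0 \<le> c" using order_trans[OF zero_le_dist step[of 0]] by simp
  \<comment> \<open>The geometric sum of the steps, multiplied by \<open>1 - q\<close> so that it
    telescopes without division.\<close>
  have b: "dist (f (n + k)) (f n) * (1 - q) \<le> c * (q ^ n - q ^ (n + k))" for n k
  proof (induction k)
    case (Suc k)
    have "dist (f (n + Suc k)) (f n) \<le> dist (f (Suc (n + k))) (f (n + k)) + dist (f (n + k)) (f n)"
      by (simp add: dist_triangle)
    also have "\<dots> \<le> c * q ^ (n + k) + dist (f (n + k)) (f n)" by (simp add: step)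
    finally have "dist (f (n + Suc k)) (f n) * (1 - q) \<le> (c * q ^ (n + k) + dist (f (n + k)) (f n)) * (1 - q)"
      using q by (simp add: mult_right_mono)
    also have "\<dots> \<le> c * q ^ (n + k) * (1 - q) + c * (q ^ n - q ^ (n + k))"
      using Suc by (simp add: distrib_right)
    also have "\<dots> = c * (q ^ n - q ^ (n + Suc k))" by (simp add: algebra_simps)
    finally show ?case .
  qed simp
  have b': "dist (f (n + k)) (f n) \<le> c / (1 - q) * q ^ n" for n k
  proof -
    have "c * (q ^ n - q ^ (n + k)) \<le> c * q ^ n" using c q by (intro mult_left_mono) auto
    with b[of n k] show ?thesis using q by (simp add: field_simps)
  qed
  have "(\<lambda>n. c / (1 - q) * q ^ n) \<longlonglongrightarrow> c / (1 - q) * 0"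
    using q by (intro tendsto_intros LIMSEQ_realpow_zero)
  then have lim: "(\<lambda>n. c / (1 - q) * q ^ n) \<longlonglongrightarrow> 0" by simp
  show ?thesis
  proof (rule metric_CauchyI)
    fix e :: real assume "e > 0"
    then have "\<forall>\<^sub>F n in sequentially. c / (1 - q) * q ^ n < e / 2"
      using order_tendstoD(2)[OF lim, of "e / 2"] by simp
    then obtain M where M: "c / (1 - q) * q ^ M < e / 2" by (meson eventually_happens sequentially_bot)
    have "dist (f m) (f n) < e" if "m \<ge> M" "n \<ge> M" for m n
    proof -
      have "dist (f m) (f M) < e / 2" "dist (f n) (f M) < e / 2"
        using b'[of M "m - M"] b'[of M "n - M"] M that
        unfolding le_add_diff_inverse[OF that(1)] le_add_diff_inverse[OF that(2)] by linarith+
      then show ?thesis by (rule dist_triangle_half_l)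
    qed
    then show "\<exists>M. \<forall>m\<ge>M. \<forall>n\<ge>M. dist (f m) (f n) < e" by blast
  qed
qed

text \<open>The equation \<open>(1 - Y)\<^sup>2 = 1 - N\<close> is the fixed point equation \<open>Y = (N + Y\<^sup>2) / 2\<close>.\<close>

fun sqrt_iterate :: "('a::real_normed_vector \<Rightarrow> 'a) \<Rightarrow> nat \<Rightarrow> 'a \<Rightarrow> 'a" where
  "sqrt_iterate N 0 x = 0"
| "sqrt_iterate N (Suc n) x = (1 / 2) *\<^sub>R (N x + sqrt_iterate N n (sqrt_iterate N n x))"

lemma bounded_linear_sqrt_iterate:
  "bounded_linear N \<Longrightarrow> bounded_linear (sqrt_iterate N n)"
proof (induction n)
  case 0
  have "sqrt_iterate N 0 = (\<lambda>x. 0)" by auto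
  then show ?case by (simp add: bounded_linear_zero)
next
  case (Suc n)
  then show ?case
    by (simp add: bounded_linear_compose[OF bounded_linear_scaleR_right] bounded_linear_add
      bounded_linear_compose)
qed

lemma symmetric_sqrt_iterate:
  "symmetric_operator N \<Longrightarrow> symmetric_operator (sqrt_iterate N n)"
  by (induction n) (simp_all add: symmetric_operator_def inner_add_left inner_add_right)

text \<open>The iteration preserves the ball of radius \<open>q\<close>, because (q + q^2) / 2 <=
  q.\<close>

lemma norm_sqrt_iterate_le:
  assumes q: "0 \<le> q" "q < 1" and N: "\<And>x. norm (N x) \<le> q * norm x"
  shows "norm (sqrt_iterate N n x) \<le> q * norm x"
proof (induction n arbitrary: x)
  case (Suc n)
  let ?Y = "sqrt_iterate N n"
  have "norm (?Y (?Y x)) \<le> q * norm (?Y x)" by (rule Suc)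
  also have "\<dots> \<le> 1 * (q * norm x)" using q Suc by (intro mult_mono) auto
  finally have "norm (N x + ?Y (?Y x)) \<le> q * norm x + q * norm x"
    using N[of x] norm_triangle_ineq[of "N x" "?Y (?Y x)"] by linarith
  then show ?case by simp
qed (simp add: q)

text \<open>Consecutive iterates Y, Z satisfy Z^2 - Y^2 = Z (Z - Y) + (Z - Y) Y. Both terms are at
  most q times the previous difference, and the factor 1/2 compensates for their number; no
  commutation of Y and Z is needed.\<close>

lemma sqrt_iterate_step_le:
  assumes q: "0 \<le> q" "q < 1" and N: "bounded_linear N" "\<And>x. norm (N x) \<le> q * norm x"
  shows "norm (sqrt_iterate N (Suc n) x - sqrt_iterate N n x) \<le> q ^ n * norm x"
proof (induction n arbitrary: x)
  case 0
  have "norm (N x) \<le> 1 * norm x"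
    using N(2)[of x] mult_right_mono[of q 1 "norm x"] q by simp
  then have "norm (N x) \<le> norm x * 2" using norm_ge_zero[of x] by linarith
  then show ?case by simp
next
  case (Suc n)
  define Y Z where "Y = sqrt_iterate N n" and "Z = sqrt_iterate N (Suc n)"
  have Z: "Z (u - v) = Z u - Z v" for u v
    unfolding Z_def by (intro linear_diff bounded_linear.linear bounded_linear_sqrt_iterate N)
  have IH: "norm (Z u - Y u) \<le> q ^ n * norm u" for u using Suc by (simp add: Z_def Y_def)
  have "norm (Z (Z x - Y x)) \<le> q * (q ^ n * norm x)"
    using norm_sqrt_iterate_le[OF q N(2), of "Suc n" "Z x - Y x"] mult_left_mono[OF IH q(1)]
    unfolding Z_def by (meson order_trans)
  moreover have "norm (Z (Y x) - Y (Y x)) \<le> q ^ n * (q * norm x)"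
    using IH[of "Y x"] mult_left_mono[OF norm_sqrt_iterate_le[OF q N(2), of n x], of "q ^ n"] q
    unfolding Y_def by (meson order_trans zero_le_power)
  moreover have "norm ((Z (Z x - Y x)) + (Z (Y x) - Y (Y x)))
      \<le> norm (Z (Z x - Y x)) + norm (Z (Y x) - Y (Y x))" by (rule norm_triangle_ineq)
  ultimately have b: "norm ((Z (Z x - Y x)) + (Z (Y x) - Y (Y x))) \<le> 2 * (q ^ Suc n * norm x)"
    by (simp add: ac_simps)
  have "sqrt_iterate N (Suc (Suc n)) x - sqrt_iterate N (Suc n) x
      = (1 / 2) *\<^sub>R (N x + Z (Z x)) - (1 / 2) *\<^sub>R (N x + Y (Y x))"
    by (simp only: sqrt_iterate.simps(2)[of N "Suc n"] sqrt_iterate.simps(2)[of N n x] Z_def Y_def)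
  also have "\<dots> = (1 / 2) *\<^sub>R ((Z (Z x - Y x)) + (Z (Y x) - Y (Y x)))"
    by (simp add: Z algebra_simps)
  finally show ?case using b by (simp only: norm_scaleR)
qed

text \<open>Every iterate is a polynomial in \<open>N\<close>.\<close>

lemma sqrt_iterate_commute:
  assumes N: "bounded_linear Z" "\<And>x. Z (N x) = N (Z x)"
  shows "Z (sqrt_iterate N n x) = sqrt_iterate N n (Z x)"
proof (induction n arbitrary: x)
  case 0
  show ?case using linear_0[OF bounded_linear.linear[OF N(1)]] by simp
next
  case (Suc n)
  show ?case
    by (simp add: linear_add[OF bounded_linear.linear[OF N(1)]]
      linear_scale[OF bounded_linear.linear[OF N(1)]] N(2) Suc)
qed

text \<open>The iterates converge at each vector. The bound \<open>q\<close>, symmetry and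
  commutation relations all survive this pointwise limit.\<close>

lemma sqrt_of_contraction:
  fixes N :: "'a::{real_inner, complete_space} \<Rightarrow> 'a"
  assumes q: "0 \<le> q" "q < 1" and N: "bounded_linear N" "\<And>x. norm (N x) \<le> q * norm x"
    and sym: "symmetric_operator N"
  obtains Y where "bounded_linear Y" "symmetric_operator Y" "\<And>x. norm (Y x) \<le> q * norm x"
    "\<And>x. N x + Y (Y x) = 2 *\<^sub>R Y x"
    "\<forall>Z. bounded_linear Z \<longrightarrow> (\<forall>x. Z (N x) = N (Z x)) \<longrightarrow> (\<forall>x. Z (Y x) = Y (Z x))"
proof -
  let ?Y = "sqrt_iterate N"
  have "Cauchy (\<lambda>n. ?Y n x)" for x
    by (rule Cauchy_of_geometric_steps[OF q, where c = "norm x"])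
      (use sqrt_iterate_step_le[OF q N] in \<open>simp only: dist_norm mult.commute\<close>)
  then have "\<forall>x. \<exists>l. (\<lambda>n. ?Y n x) \<longlonglongrightarrow> l"
    unfolding Cauchy_convergent_iff convergent_def by blast
  then obtain Y where Y: "\<And>x. (\<lambda>n. ?Y n x) \<longlonglongrightarrow> Y x" by metis
  have bl: "bounded_linear (?Y n)" for n by (rule bounded_linear_sqrt_iterate[OF N(1)])
  note lin = bounded_linear.linear[OF bl]
  have nY: "norm (Y x) \<le> q * norm x" for x
    by (rule LIMSEQ_le_const2[OF tendsto_norm[OF Y]]) (use norm_sqrt_iterate_le[OF q N(2)] in blast)
  have blY: "bounded_linear Y"
  proof (rule bounded_linear_intro[where K = q])
    show "Y (x + y) = Y x + Y y" for x y
      by (rule LIMSEQ_unique[OF Y]) (simp only: linear_add[OF lin] tendsto_add[OF Y Y])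
    show "Y (r *\<^sub>R x) = r *\<^sub>R Y x" for r x
      by (rule LIMSEQ_unique[OF Y]) (simp only: linear_scale[OF lin] tendsto_scaleR[OF tendsto_const Y])
  qed (use nY in \<open>simp add: mult.commute\<close>)
  have symY: "symmetric_operator Y" unfolding symmetric_operator_def
  proof (intro allI)
    fix x y
    have "(\<lambda>n. ?Y n x \<bullet> y) \<longlonglongrightarrow> Y x \<bullet> y" by (intro tendsto_intros Y)
    moreover have "(\<lambda>n. ?Y n x \<bullet> y) \<longlonglongrightarrow> x \<bullet> Y y"
      unfolding symmetric_operatorD[OF symmetric_sqrt_iterate[OF sym]] by (intro tendsto_intros Y)
    ultimately show "Y x \<bullet> y = x \<bullet> Y y" by (rule LIMSEQ_unique)
  qed
  \<comment> \<open>Squaring is compatible with the pointwise limit because the iterates share the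
    bound \<open>q\<close>: split the inner vector into its limit and an error tending to 0.\<close>
  have YY: "(\<lambda>n. ?Y n (?Y n x)) \<longlonglongrightarrow> Y (Y x)" for x
  proof -
    have "(\<lambda>n. ?Y n (?Y n x - Y x)) \<longlonglongrightarrow> 0"
    proof (rule Lim_null_comparison)
      show "\<forall>\<^sub>F n in sequentially. norm (?Y n (?Y n x - Y x)) \<le> q * norm (?Y n x - Y x)"
        by (simp add: norm_sqrt_iterate_le[OF q N(2)])
      have "(\<lambda>n. q * norm (?Y n x - Y x)) \<longlonglongrightarrow> q * norm (Y x - Y x)" by (intro tendsto_intros Y)
      then show "(\<lambda>n. q * norm (?Y n x - Y x)) \<longlonglongrightarrow> 0" by simp
    qed
    from tendsto_add[OF this Y[of "Y x"]] show ?thesis by (simp add: linear_diff[OF lin])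
  qed
  have fixp: "N x + Y (Y x) = 2 *\<^sub>R Y x" for x
  proof -
    have "(\<lambda>n. ?Y (Suc n) x) \<longlonglongrightarrow> (1 / 2) *\<^sub>R (N x + Y (Y x))"
      by (simp only: sqrt_iterate.simps) (intro tendsto_intros YY)
    then have "Y x = (1 / 2) *\<^sub>R (N x + Y (Y x))"
      by (rule LIMSEQ_unique[OF LIMSEQ_Suc[OF Y]])
    then have "2 *\<^sub>R Y x = 2 *\<^sub>R ((1 / 2) *\<^sub>R (N x + Y (Y x)))" by (rule arg_cong)
    then show ?thesis by simp
  qed
  have comm: "Z (Y x) = Y (Z x)" if Z: "bounded_linear Z" "\<And>x. Z (N x) = N (Z x)" for Z x
  proof (rule LIMSEQ_unique)
    show "(\<lambda>n. Z (?Y n x)) \<longlonglongrightarrow> Z (Y x)" by (rule bounded_linear.tendsto[OF Z(1) Y])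
    show "(\<lambda>n. Z (?Y n x)) \<longlonglongrightarrow> Y (Z x)" by (simp only: sqrt_iterate_commute[where N = N, OF Z] Y)
  qed
  show thesis using comm by (intro that[OF blY symY nY fixp]) blast
qed

text \<open>Writing T = c (1 - N) with N a strict contraction, the root is sqrt c (1 - Y) with (1 -
  Y)^2 = 1 - N; it is coercive since Y has norm at most q < 1. The commutation clause later makes
  the polar factors of a skew operator commute.\<close>

lemma positive_invertible_sqrt:
  fixes T :: "'a::{real_inner, complete_space} \<Rightarrow> 'a"
  assumes T: "positive_invertible T"
  obtains R where "positive_invertible R" "\<And>x. R (R x) = T x"
    "\<forall>Z. bounded_linear Z \<longrightarrow> (\<forall>x. Z (T x) = T (Z x)) \<longrightarrow> (\<forall>x. Z (R x) = R (Z x))"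
proof -
  obtain e where e: "e > 0" "\<And>x. e * (x \<bullet> x) \<le> x \<bullet> T x"
    using positive_invertible_coercive[OF T] by blast
  define N where "N c x = x - (1 / c) *\<^sub>R T x" for c x
  obtain c q where c: "c > 0" and q: "0 \<le> q" "q < 1" and N: "bounded_linear (N c)"
    "\<And>x. norm (N c x) \<le> q * norm x" "symmetric_operator (N c)"
    using coercive_contraction[OF positive_invertible_bounded_linear[OF T]
        positive_invertible_symmetric[OF T] e] unfolding N_def by metis
  obtain Y where Y: "bounded_linear Y" "symmetric_operator Y" "\<And>x. norm (Y x) \<le> q * norm x"
    "\<And>x. N c x + Y (Y x) = 2 *\<^sub>R Y x"
    "\<forall>Z. bounded_linear Z \<longrightarrow> (\<forall>x. Z (N c x) = N c (Z x)) \<longrightarrow> (\<forall>x. Z (Y x) = Y (Z x))"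
    by (rule sqrt_of_contraction[OF q N]) blast
  note linY = bounded_linear.linear[OF Y(1)]
  define R where "R = (\<lambda>x. sqrt c *\<^sub>R (x - Y x))"
  have "positive_invertible R"
  proof (rule positive_invertibleI)
    show "bounded_linear R" unfolding R_def
      by (intro bounded_linear_compose[OF bounded_linear_scaleR_right] bounded_linear_sub
        bounded_linear_ident Y)
    show "symmetric_operator R"
      using Y(2) by (simp add: symmetric_operator_def R_def inner_diff_left inner_diff_right)
    \<comment> \<open>Coercivity constant of \<open>R\<close>: the form of \<open>Y\<close> is at
      most \<open>q\<close> times the squared norm.\<close>
    show "sqrt c * (1 - q) > 0" using c q by simp
    show "sqrt c * (1 - q) * (x \<bullet> x) \<le> x \<bullet> R x" for x
    proof -
      have "x \<bullet> Y x \<le> norm x * norm (Y x)" by (rule norm_cauchy_schwarz)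
      also have "\<dots> \<le> norm x * (q * norm x)" by (intro mult_left_mono Y) simp
      finally have "(1 - q) * (x \<bullet> x) \<le> x \<bullet> x - x \<bullet> Y x"
        by (simp add: dot_square_norm power2_eq_square algebra_simps)
      then have "sqrt c * ((1 - q) * (x \<bullet> x)) \<le> sqrt c * (x \<bullet> x - x \<bullet> Y x)"
        using c by (intro mult_left_mono) auto
      then show ?thesis by (simp add: R_def inner_diff_right mult.assoc)
    qed
  qed
  moreover have "R (R x) = T x" for x
  proof -
    have "R (R x) = (sqrt c * sqrt c) *\<^sub>R (x - 2 *\<^sub>R Y x + Y (Y x))"
      unfolding R_def linear_scale[OF linY] linear_diff[OF linY]
      by (simp add: algebra_simps scaleR_2)
    also have "\<dots> = c *\<^sub>R (x - N c x)" using c by (simp flip: Y(4))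
    finally show ?thesis using c by (simp add: N_def)
  qed
  moreover have "Z (R x) = R (Z x)" if Z: "bounded_linear Z" "\<And>x. Z (T x) = T (Z x)" for Z x
  proof -
    note l = bounded_linear.linear[OF Z(1)]
    have "Z (Y x) = Y (Z x)"
      by (rule Y(5)[rule_format, OF Z(1)]) (simp add: N_def linear_diff[OF l] linear_scale[OF l] Z(2))
    then show ?thesis by (simp add: R_def linear_diff[OF l] linear_scale[OF l])
  qed
  ultimately show thesis by (intro that) blast+
qed

section \<open>Maximal invariant Lagrangian subspaces\<close>

text \<open>Zorn's lemma for sets of pairwise related elements. Since \<open>r x x\<close> is
  demanded too, conditions on single vectors, such as having norm one, can be encoded in
  \<open>r\<close>.\<close>

lemma exists_maximal_clique:
  obtains M where "\<And>x y. x \<in> M \<Longrightarrow> y \<in> M \<Longrightarrow> r x y"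
    "\<And>z. r z z \<Longrightarrow> (\<And>x. x \<in> M \<Longrightarrow> r x z \<and> r z x) \<Longrightarrow> z \<in> M"
proof -
  define Q where "Q = {S. \<forall>x\<in>S. \<forall>y\<in>S. r x y}"
  have "\<exists>M\<in>Q. \<forall>X\<in>Q. M \<subseteq> X \<longrightarrow> X = M"
  proof (rule subset_Zorn')
    fix C assume C: "subset.chain Q C"
    show "\<Union> C \<in> Q" unfolding Q_def mem_Collect_eq
    proof (intro ballI)
      fix x y assume "x \<in> \<Union> C" "y \<in> \<Union> C"
      then obtain X Y where X: "X \<in> C" "x \<in> X" and Y: "Y \<in> C" "y \<in> Y" by blast
      from subset.chain_total[OF C X(1) Y(1)] C X Y show "r x y"
        unfolding subset.chain_def Q_def by blast
    qed
  qed
  then obtain M where M: "M \<in> Q" "\<And>X. X \<in> Q \<Longrightarrow> M \<subseteq> X \<Longrightarrow> X = M" by metis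
  have "z \<in> M" if "r z z" "\<And>x. x \<in> M \<Longrightarrow> r x z \<and> r z x" for z
  proof -
    have "insert z M \<in> Q" using M(1) that by (auto simp: Q_def)
    from M(2)[OF this] show ?thesis by blast
  qed
  then show thesis
  proof (rule that[rotated])
    show "r x y" if "x \<in> M" "y \<in> M" for x y using M(1) that by (simp add: Q_def)
  qed
qed

text \<open>A maximal set for \<open>r\<close> equals its own annihilator under \<open>r\<close>,
  hence is a closed subspace, and is C-invariant because moving \<open>C\<close> across the inner
  product only raises the index \<open>n\<close>. If w is orthogonal to \<open>S\<close>, then U w
  is again annihilated by all of \<open>S\<close>, so U w lies in \<open>S\<close>: nothing is left
  outside \<open>S\<close> + U \<open>S\<close>.\<close>

lemma exists_lagrangian_decomposition:
  fixes U C :: "'g::{real_inner, complete_space} \<Rightarrow> 'g"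
  assumes U: "bounded_linear U" "\<And>x y. U x \<bullet> y = - (x \<bullet> U y)" "\<And>x. U (U x) = - x"
    and C: "bounded_linear C" "symmetric_operator C" "\<And>x. U (C x) = C (U x)"
  obtains S where "subspace S" "closed S" "\<And>x. x \<in> S \<Longrightarrow> C x \<in> S"
    "\<And>x y. x \<in> S \<Longrightarrow> y \<in> S \<Longrightarrow> x \<bullet> U y = 0" "\<And>z. \<exists>x\<in>S. \<exists>y\<in>S. z = x + U y"
proof -
  define V where "V n x = U ((C ^^ n) x)" for n x
  have Cs: "(C ^^ n) x \<bullet> y = x \<bullet> (C ^^ n) y" for n x y
  proof (induction n arbitrary: x y)
    case (Suc n)
    then show ?case
      using symmetric_operatorD[OF C(2)] by (simp add: funpow_swap1)
  qed simp
  have UCn: "U ((C ^^ n) x) = (C ^^ n) (U x)" for n x by (induction n) (simp_all add: C(3))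
  have skew: "V n x \<bullet> y = - (x \<bullet> V n y)" for n x y
    unfolding V_def by (simp add: U(2) Cs UCn)
  have Cbl: "bounded_linear (C ^^ n)" for n
    by (induction n) (auto simp: id_def comp_def bounded_linear_ident intro: bounded_linear_compose[OF C(1)])
  have VC: "V n (C x) = V (Suc n) x" for n x by (simp add: V_def funpow_swap1)
  define r where "r x y \<longleftrightarrow> (\<forall>n. x \<bullet> V n y = 0)" for x y
  obtain S where S: "\<And>x y. x \<in> S \<Longrightarrow> y \<in> S \<Longrightarrow> r x y"
    and Smax: "\<And>z. r z z \<Longrightarrow> (\<And>x. x \<in> S \<Longrightarrow> r x z \<and> r z x) \<Longrightarrow> z \<in> S"
    by (rule exists_maximal_clique[of r]) blast
  \<comment> \<open>A skew operator has zero quadratic form, so no single vector obstructs enlarging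
    \<open>S\<close>.\<close>
  have rzz: "r z z" for z
    unfolding r_def using skew[of _ z z] by (simp add: inner_commute)
  have rsym: "r x z" if "r z x" for x z
    using that skew unfolding r_def by (metis inner_commute neg_0_equal_iff_equal)
  have mem: "z \<in> S \<longleftrightarrow> (\<forall>x\<in>S. r z x)" for z
    using S Smax[OF rzz] rsym by blast
  have S_eq: "S = {z. \<forall>x\<in>S. \<forall>n. z \<bullet> V n x = 0}" using mem unfolding r_def by blast
  have "subspace {z. \<forall>x\<in>S. \<forall>n. z \<bullet> V n x = 0}"
    by (auto simp: subspace_def inner_add_left)
  then have sub: "subspace S" using S_eq by simp
  have "closed {z. \<forall>x\<in>S. \<forall>n. z \<bullet> V n x = 0}"
  proof -
    have "{z. \<forall>x\<in>S. \<forall>n. z \<bullet> V n x = 0} = (\<Inter>x\<in>S. \<Inter>n. {z. z \<bullet> V n x = 0})" by auto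
    also have "closed \<dots>"
      by (intro closed_INT ballI closed_Collect_eq continuous_intros)
    finally show ?thesis .
  qed
  then have cl: "closed S" using S_eq by simp
  have CS: "C x \<in> S" if "x \<in> S" for x
  proof -
    have "C x \<bullet> V n y = 0" if "y \<in> S" for y n
    proof -
      \<comment> \<open>\<open>C\<close> is symmetric and commutes with \<open>U\<close>, so it is
        absorbed as one more power.\<close>
      have "C x \<bullet> V n y = x \<bullet> V (Suc n) y"
        using symmetric_operatorD[OF C(2), of x "V n y"] by (simp add: V_def C(3))
      then show ?thesis using S[OF \<open>x \<in> S\<close> that] by (simp only: r_def)
    qed
    then show ?thesis using mem[of "C x"] unfolding r_def by blast
  qed
  have CnS: "(C ^^ n) x \<in> S" if "x \<in> S" for x n by (induction n) (simp_all add: that CS)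
  have lag: "x \<bullet> U y = 0" if "x \<in> S" "y \<in> S" for x y
    using S[OF that] by (simp add: r_def V_def) (metis funpow_0)
  have "\<exists>x\<in>S. \<exists>y\<in>S. z = x + U y" for z
  proof -
    obtain s where s: "s \<in> S" "\<And>t. t \<in> S \<Longrightarrow> (z - s) \<bullet> t = 0"
      using exists_orthogonal_projection[OF sub cl] by metis
    have "U (z - s) \<in> S"
    proof -
      \<comment> \<open>\<open>U\<close> preserves inner products, which leaves
        \<open>(z - s) \<bullet> (C ^^ n) x\<close>; here \<open>(C ^^ n) x\<close> is in
        \<open>S\<close>.\<close>
      have "U (z - s) \<bullet> V n x = 0" if "x \<in> S" for x n
        using s(2)[OF CnS[OF that, of n]] by (simp add: V_def U(2,3))
      then show ?thesis using mem[of "U (z - s)"] unfolding r_def by blast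
    qed
    then have "- U (z - s) \<in> S" by (rule subspace_neg[OF sub])
    moreover have "U (- U (z - s)) = z - s"
      by (simp add: linear_neg[OF bounded_linear.linear[OF U(1)]] U(3))
    ultimately show ?thesis using s(1) by (metis add_diff_cancel_left' diff_add_cancel add.commute)
  qed
  with sub cl CS lag show thesis by (rule that)
qed

section \<open>Orthonormal bases and isometries\<close>

text \<open>Completeness is expressed by a trivial orthogonal complement inside \<open>S\<close>,
  which is what maximality delivers and needs no infinite sums.\<close>

definition orthonormal_basis :: "'a::real_inner set \<Rightarrow> 'a set \<Rightarrow> bool" where
  "orthonormal_basis S E \<longleftrightarrow> E \<subseteq> S \<and> pairwise orthogonal E \<and> (\<forall>e\<in>E. norm e = 1) \<and>
     (\<forall>x\<in>S. (\<forall>e\<in>E. x \<bullet> e = 0) \<longrightarrow> x = 0)"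

lemma orthonormal_basis_inner:
  assumes "orthonormal_basis S E" "e \<in> E" "f \<in> E"
  shows "e \<bullet> f = (if e = f then 1 else 0)"
  using assms unfolding orthonormal_basis_def pairwise_def orthogonal_def
  by (auto simp: dot_square_norm)

text \<open>A nonzero vector orthogonal to a maximal orthonormal set would, once normalised, belong
  to the set and be orthogonal to itself.\<close>

lemma exists_orthonormal_basis:
  fixes S :: "'a::real_inner set"
  assumes S: "subspace S"
  obtains E where "orthonormal_basis S E"
proof -
  define r where "r x y \<longleftrightarrow> x \<in> S \<and> norm x = 1 \<and> y \<in> S \<and> norm y = 1 \<and> (x \<noteq> y \<longrightarrow> x \<bullet> y = 0)" for x y
  obtain E where E: "\<And>x y. x \<in> E \<Longrightarrow> y \<in> E \<Longrightarrow> r x y"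
    and Emax: "\<And>z. r z z \<Longrightarrow> (\<And>x. x \<in> E \<Longrightarrow> r x z \<and> r z x) \<Longrightarrow> z \<in> E"
    using exists_maximal_clique[of r] by blast
  have "x = 0" if x: "x \<in> S" "\<forall>e\<in>E. x \<bullet> e = 0" for x
  proof (rule ccontr)
    assume "x \<noteq> 0"
    define z where "z = (1 / norm x) *\<^sub>R x"
    have z: "z \<in> S" "norm z = 1" using x \<open>x \<noteq> 0\<close> S by (simp_all add: z_def subspace_scale)
    have "z \<bullet> e = 0" if "e \<in> E" for e using x that by (simp add: z_def)
    then have "z \<in> E" using z E by (intro Emax) (auto simp: r_def inner_commute)
    then have "x \<bullet> z = 0" using x by blast
    then have "z \<bullet> z = 0" by (simp add: z_def)
    then show False using z by simp
  qed
  then have "orthonormal_basis S E"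
    using E unfolding orthonormal_basis_def pairwise_def orthogonal_def r_def by blast
  then show thesis by (rule that)
qed

lemma independent_orthonormal_basis: "orthonormal_basis S E \<Longrightarrow> independent E"
  unfolding orthonormal_basis_def by (intro pairwise_orthogonal_independent) auto

lemma orthonormal_basis_expansion:
  assumes S: "subspace S" and E: "orthonormal_basis S E" and fin: "finite E" and x: "x \<in> S"
  shows "(\<Sum>e\<in>E. (x \<bullet> e) *\<^sub>R e) = x"
proof -
  define y where "y = (\<Sum>e\<in>E. (x \<bullet> e) *\<^sub>R e)"
  have "y \<in> S"
    unfolding y_def using E S by (intro subspace_sum subspace_scale) (auto simp: orthonormal_basis_def)
  have "(x - y) \<bullet> e = 0" if e: "e \<in> E" for e
  proof -
    have "y \<bullet> e = (\<Sum>f\<in>E. (x \<bullet> f) * (if f = e then 1 else 0))"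
      unfolding y_def inner_sum_left using orthonormal_basis_inner[OF E _ e]
      by (intro sum.cong) auto
    also have "\<dots> = x \<bullet> e" using fin e by (simp add: if_distrib cong: if_cong)
    finally show ?thesis by (simp add: inner_diff_left)
  qed
  then have "x - y = 0"
    using E x \<open>y \<in> S\<close> S subspace_diff unfolding orthonormal_basis_def by blast
  then show ?thesis by (simp add: y_def)
qed

lemma orthonormal_basis_span:
  assumes S: "subspace S" and E: "orthonormal_basis S E" and fin: "finite E"
  shows "S = span E"
proof
  show "span E \<subseteq> S" using E S by (intro span_minimal) (simp_all add: orthonormal_basis_def)
  show "S \<subseteq> span E"
  proof
    fix x assume x: "x \<in> S"
    have "(\<Sum>e\<in>E. (x \<bullet> e) *\<^sub>R e) \<in> span E" by (intro span_sum span_scale span_base)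
    then show "x \<in> span E" by (simp only: orthonormal_basis_expansion[OF S E fin x])
  qed
qed

lemma orthonormal_bases_finite_card:
  assumes "subspace S" "orthonormal_basis S E" "orthonormal_basis S F" "finite F"
  shows "finite E \<and> card E \<le> card F"
  using independent_span_bound[OF assms(4) independent_orthonormal_basis[OF assms(2)]]
    orthonormal_basis_span[OF assms(1,3,4)] assms(2) by (simp add: orthonormal_basis_def)

text \<open>Distinct orthonormal vectors have distance sqrt 2, so points of \<open>D\<close> within
  1/2 of them are distinct.\<close>

lemma countable_orthonormal_basis:
  fixes S :: "'a::real_inner set"
  assumes D: "countable D" "closure D = (UNIV :: 'a set)" and E: "orthonormal_basis S E"
  shows "countable E"
proof -
  have "\<forall>e\<in>E. \<exists>d\<in>D. dist d e < 1/2"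
    using D(2) closure_approachable[of _ D] by (metis UNIV_I half_gt_zero zero_less_one)
  then obtain d where d: "\<And>e. e \<in> E \<Longrightarrow> d e \<in> D" "\<And>e. e \<in> E \<Longrightarrow> dist (d e) e < 1/2" by metis
  have "inj_on d E"
  proof (rule inj_onI, rule ccontr)
    fix e f assume ef: "e \<in> E" "f \<in> E" "d e = d f" "e \<noteq> f"
    have "dist e f < 1"
      using d(2)[OF ef(1)] d(2)[OF ef(2)] ef(3) dist_triangle_half_r[of "d e" e 1 f] by simp
    then have "(dist e f)\<^sup>2 < 1\<^sup>2" by (intro power_strict_mono) auto
    moreover have "(dist e f)\<^sup>2 = 2"
      using orthonormal_basis_inner[OF E] ef
      by (simp add: dist_norm power2_norm_eq_inner inner_diff_left inner_diff_right)
    ultimately show False by simp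
  qed
  moreover have "countable (d ` E)" using D(1) d(1) by (meson countable_subset image_subsetI)
  ultimately show ?thesis by (rule countable_image_inj_on[rotated])
qed

text \<open>The part of a vector of \<open>S\<close> orthogonal to \<open>W\<close> is orthogonal to
  the whole basis, hence zero. This takes the place of density of the span.\<close>

lemma closed_subspace_contains_onb:
  fixes S :: "'a::{real_inner, complete_space} set"
  assumes S: "subspace S" and E: "orthonormal_basis S E"
    and W: "subspace W" "closed W" "E \<subseteq> W" "W \<subseteq> S"
  shows "W = S"
proof
  show "S \<subseteq> W"
  proof
    fix x assume x: "x \<in> S"
    obtain w where w: "w \<in> W" "\<And>t. t \<in> W \<Longrightarrow> (x - w) \<bullet> t = 0"
      using exists_orthogonal_projection[OF W(1,2)] by metis
    have "x - w \<in> S" using x w W S subspace_diff by blast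
    moreover have "\<forall>e\<in>E. (x - w) \<bullet> e = 0" using w W by blast
    ultimately have "x - w = 0" using E unfolding orthonormal_basis_def by blast
    then show "x \<in> W" using w by simp
  qed
qed (rule W)

lemma subspace_closure:
  fixes S :: "'a::real_normed_vector set"
  assumes S: "subspace S"
  shows "subspace (closure S)"
  unfolding subspace_def
proof (intro conjI ballI allI)
  show "0 \<in> closure S" using S closure_subset subspace_0 by blast
next
  fix x y assume "x \<in> closure S" "y \<in> closure S"
  then obtain f g where f: "\<And>n. f n \<in> S" "f \<longlonglongrightarrow> x" and g: "\<And>n. g n \<in> S" "g \<longlonglongrightarrow> y"
    unfolding closure_sequential by metis
  then have "(\<lambda>n. f n + g n) \<longlonglongrightarrow> x + y" "\<And>n. f n + g n \<in> S"
    using S by (auto intro: tendsto_add subspace_add)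
  then show "x + y \<in> closure S" unfolding closure_sequential by (intro exI[of _ "\<lambda>n. f n + g n"]) simp
next
  fix x c assume "x \<in> closure S"
  then obtain f where f: "\<And>n. f n \<in> S" "f \<longlonglongrightarrow> x"
    unfolding closure_sequential by metis
  then have "(\<lambda>n. c *\<^sub>R f n) \<longlonglongrightarrow> c *\<^sub>R x" "\<And>n. c *\<^sub>R f n \<in> S"
    using S by (auto intro: tendsto_intros subspace_scale)
  then show "c *\<^sub>R x \<in> closure S"
    unfolding closure_sequential by (intro exI[of _ "\<lambda>n. c *\<^sub>R f n"]) simp
qed

text \<open>The graph of the isometry is the closed span of the pairs of corresponding basis vectors.\<close>

lemma exists_isometry_onto:
  fixes S :: "'g::{real_inner, complete_space} set"
    and E :: "'a::{real_inner, complete_space} set"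
  assumes S: "subspace S" "closed S" and E: "orthonormal_basis UNIV E" and F: "orthonormal_basis S F"
    and b: "bij_betw b E F"
  obtains T :: "'a \<Rightarrow> 'g" where "bounded_linear T" "\<And>x y. T x \<bullet> T y = x \<bullet> y" "range T = S"
proof -
  define B where "B = (\<lambda>e. (e, b e)) ` E"
  define G where "G = closure (span B)"
  have subG: "subspace G" unfolding G_def by (intro subspace_closure subspace_span)
  have cG: "complete G" unfolding G_def by (simp add: complete_eq_closed)
  have BG: "B \<subseteq> G" unfolding G_def using span_superset closure_subset by blast
  \<comment> \<open>The relation is linear and closed in each argument, so it spreads from pairs of
    basis vectors to all of \<open>G\<close>.\<close>
  define P where "P p q \<longleftrightarrow> fst p \<bullet> fst q = snd p \<bullet> snd q" for p q :: "'a \<times> 'g"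
  have Psub: "subspace {p. P p q}" for q
    by (auto simp: P_def subspace_def inner_add_left)
  have Pcl: "closed {p. P p q}" for q
    unfolding P_def by (intro closed_Collect_eq continuous_intros)
  have Pcomm: "P p q \<longleftrightarrow> P q p" for p q by (auto simp: P_def inner_commute)
  have Pext: "P p q" if "\<And>p. p \<in> B \<Longrightarrow> P p q" "p \<in> G" for p q
  proof -
    have "G \<subseteq> {p. P p q}" unfolding G_def using that(1)
      by (intro closure_minimal span_minimal Psub Pcl) auto
    then show ?thesis using that(2) by blast
  qed
  have PB: "P p q" if pq: "p \<in> B" "q \<in> B" for p q
  proof -
    obtain e f where ef: "e \<in> E" "f \<in> E" "p = (e, b e)" "q = (f, b f)"
      using pq unfolding B_def by blast
    have bef: "b e \<in> F" "b f \<in> F" "b e = b f \<longleftrightarrow> e = f"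
      using b ef(1,2) by (auto simp: bij_betw_def inj_on_def)
    show ?thesis
      using orthonormal_basis_inner[OF E ef(1,2)] orthonormal_basis_inner[OF F bef(1,2)] bef(3)
      by (simp add: P_def ef(3,4))
  qed
  have PG: "P p q" if "p \<in> G" "q \<in> G" for p q
    using Pext[OF _ that(1)] Pext[OF _ that(2)] PB Pcomm by blast
  have nrm: "norm (fst p) = norm (snd p)" if "p \<in> G" for p
    using PG[OF that that] by (simp add: P_def norm_eq)
  \<comment> \<open>On \<open>G\<close> both components have the same norm, and the pair has at most
    the sum of the two. The projections of \<open>G\<close> are thus bounded below and have complete
    images.\<close>
  have half: "1/2 * norm p \<le> norm (fst p)" "1/2 * norm p \<le> norm (snd p)" if "p \<in> G" for p
    using norm_Pair_le[of "fst p" "snd p"] nrm[OF that] by simp_all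
  have "complete (fst ` G)"
    by (rule complete_isometric_image[OF _ subG bounded_linear_fst _ cG, of "1/2"]) (use half in auto)
  moreover have "E \<subseteq> fst ` G" using BG by (force simp: B_def)
  ultimately have fstG: "fst ` G = UNIV"
    by (intro closed_subspace_contains_onb[OF subspace_UNIV E])
      (simp_all add: complete_eq_closed linear_subspace_image[OF bounded_linear.linear[OF bounded_linear_fst]] subG)
  have "complete (snd ` G)"
    by (rule complete_isometric_image[OF _ subG bounded_linear_snd _ cG, of "1/2"]) (use half in auto)
  moreover have "F \<subseteq> snd ` G" using BG b by (force simp: B_def bij_betw_def)
  moreover have "snd ` G \<subseteq> S"
  proof -
    have "B \<subseteq> {p. snd p \<in> S}" using b F by (auto simp: B_def bij_betw_def orthonormal_basis_def)
    moreover have "subspace {p :: 'a \<times> 'g. snd p \<in> S}"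
      using S(1) by (auto simp: subspace_def)
    moreover have "closed {p :: 'a \<times> 'g. snd p \<in> S}"
      using closed_vimage_snd[OF S(2)] by (simp add: vimage_def)
    ultimately have "G \<subseteq> {p. snd p \<in> S}" unfolding G_def by (meson closure_minimal span_minimal)
    then show ?thesis by blast
  qed
  ultimately have sndG: "snd ` G = S"
    by (intro closed_subspace_contains_onb[OF S(1) F])
      (simp_all add: complete_eq_closed linear_subspace_image[OF bounded_linear.linear[OF bounded_linear_snd]] subG)
  have "\<forall>x. \<exists>y. (x, y) \<in> G" using fstG by (metis UNIV_I imageE prod.collapse)
  then obtain T where T: "\<And>x. (x, T x) \<in> G" by metis
  \<comment> \<open>Two pairs with the same first component differ by one with first component 0,
    whose second component then also vanishes.\<close>
  have T_eq: "y = T x" if "(x, y) \<in> G" for x y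
  proof -
    have "(x, y) - (x, T x) \<in> G" by (rule subspace_diff[OF subG that T])
    then have "norm (y - T x) = 0" using nrm by fastforce
    then show ?thesis by simp
  qed
  show thesis
  proof (rule that[of T])
    have "norm (T x) = norm x" for x using nrm[OF T[of x]] by simp
    then show "bounded_linear T"
    proof (intro bounded_linear_intro[where K = 1])
      show "T (x + y) = T x + T y" for x y
        using T_eq subspace_add[OF subG T[of x] T[of y]] by simp
      show "T (r *\<^sub>R x) = r *\<^sub>R T x" for r x
        by (rule T_eq[symmetric]) (use subspace_scale[OF subG T[of x], of r] in simp)
    qed simp
    show "T x \<bullet> T y = x \<bullet> y" for x y using PG[OF T[of x] T[of y]] by (simp add: P_def)
    show "range T = S"
    proof
      show "range T \<subseteq> S" using sndG T by force
      show "S \<subseteq> range T" using sndG T_eq by fastforce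
    qed
  qed
qed

section \<open>The symplectic structure on the double space\<close>

lemma J_op_simps: "J_op (x, y) = (y, - x)" "fst (J_op p) = snd p" "snd (J_op p) = - fst p"
  by (simp_all add: J_op_def split: prod.splits)

lemma J_op_J_op [simp]: "J_op (J_op x) = - x"
  by (cases x) (simp add: J_op_simps)

lemma J_op_uminus [simp]: "J_op (- x) = - J_op x"
  by (cases x) (simp add: J_op_simps)

lemma inner_J_op: "J_op x \<bullet> y = - (x \<bullet> J_op y)"
  by (cases x; cases y) (simp add: J_op_simps inner_commute)

lemma inner_J_op_J_op [simp]: "J_op x \<bullet> J_op y = x \<bullet> y"
  by (cases x; cases y) (simp add: J_op_simps)

lemma J_op_map_prod: "linear P \<Longrightarrow> J_op (map_prod P P x) = map_prod P P (J_op x)"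
  by (cases x) (simp add: J_op_simps linear_neg)

lemma bounded_linear_J_op: "bounded_linear (J_op :: 'a::real_inner \<times> 'a \<Rightarrow> _)"
proof (rule bounded_linear_intro[where K = 1])
  fix x y :: "'a \<times> 'a" and r :: real
  show "J_op (x + y) = J_op x + J_op y" by (cases x; cases y) (simp add: J_op_simps)
  show "J_op (r *\<^sub>R x) = r *\<^sub>R J_op x" by (cases x) (simp add: J_op_simps)
  show "norm (J_op x) \<le> norm x * 1" by (cases x) (simp add: J_op_simps norm_Pair add.commute)
qed

lemma bounded_invertible_J_op: "bounded_invertible (J_op :: 'a::real_inner \<times> 'a \<Rightarrow> _)"
  by (rule bounded_invertibleI_inverse[where S = "\<lambda>x. - J_op x"])
    (simp_all add: bounded_linear_J_op bounded_linear_minus)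

lemma bounded_linear_map_prod:
  assumes "bounded_linear P"
  shows "bounded_linear (map_prod P P)"
  unfolding map_prod_def split_beta
  by (intro bounded_linear_Pair bounded_linear_compose[OF assms] bounded_linear_fst bounded_linear_snd)

lemma positive_invertible_map_prod:
  fixes P :: "'a::{real_inner, complete_space} \<Rightarrow> 'a"
  assumes P: "positive_invertible P"
  shows "positive_invertible (map_prod P P)"
proof -
  obtain e where e: "e > 0" "\<And>x. e * (x \<bullet> x) \<le> x \<bullet> P x"
    using positive_invertible_coercive[OF P] by blast
  show ?thesis
  proof (rule positive_invertibleI[OF _ _ e(1)])
    show "bounded_linear (map_prod P P)"
      by (rule bounded_linear_map_prod[OF positive_invertible_bounded_linear[OF P]])
    show "symmetric_operator (map_prod P P)"
      using positive_invertible_symmetric[OF P] by (simp add: symmetric_operator_def)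
    show "e * (x \<bullet> x) \<le> x \<bullet> map_prod P P x" for x
      using add_mono[OF e(2)[of "fst x"] e(2)[of "snd x"]]
      by (cases x) (simp add: distrib_left)
  qed
qed

lemma exists_dense_countable_prod:
  assumes "separable_space (euclidean :: 'a::real_normed_vector topology)"
  obtains D :: "('a::real_normed_vector \<times> 'a) set" where "countable D" "closure D = UNIV"
proof -
  obtain C :: "'a set" where "countable C" "closure C = UNIV"
    using assms by (auto simp: separable_space_def)
  then show thesis using that[of "C \<times> C"] by (simp add: closure_Times)
qed

lemma orthonormal_basis_double:
  assumes E: "orthonormal_basis (UNIV :: 'a::real_inner set) E"
  shows "orthonormal_basis (UNIV :: ('a \<times> 'a) set) ((\<lambda>e. (e, 0)) ` E \<union> (\<lambda>e. (0, e)) ` E)"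
    and "finite E \<Longrightarrow> card ((\<lambda>e. (e, 0)) ` E \<union> (\<lambda>e. (0, e)) ` E) = 2 * card E"
proof -
  have E1: "\<And>e. e \<in> E \<Longrightarrow> norm e = 1" "\<And>e f. e \<in> E \<Longrightarrow> f \<in> E \<Longrightarrow> e \<noteq> f \<Longrightarrow> e \<bullet> f = 0"
    "\<And>x. (\<And>e. e \<in> E \<Longrightarrow> x \<bullet> e = 0) \<Longrightarrow> x = 0"
    using E by (auto simp: orthonormal_basis_def pairwise_def orthogonal_def)
  show "orthonormal_basis UNIV ((\<lambda>e. (e, 0)) ` E \<union> (\<lambda>e. (0, e)) ` E)"
    unfolding orthonormal_basis_def
  proof (intro conjI ballI impI)
    show "pairwise orthogonal ((\<lambda>e. (e, 0)) ` E \<union> (\<lambda>e. (0, e)) ` E)"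
      using E1(2) by (auto simp: pairwise_def orthogonal_def; blast)
    show "norm p = 1" if "p \<in> (\<lambda>e. (e, 0)) ` E \<union> (\<lambda>e. (0, e)) ` E" for p
      using that E1(1) by (auto simp: norm_Pair)
    fix p :: "'a \<times> 'a" assume p: "\<forall>e\<in>(\<lambda>e. (e, 0)) ` E \<union> (\<lambda>e. (0, e)) ` E. p \<bullet> e = 0"
    have "fst p \<bullet> e = 0" "snd p \<bullet> e = 0" if "e \<in> E" for e
      using p[rule_format, of "(e, 0)"] p[rule_format, of "(0, e)"] that by (cases p; auto)+
    then show "p = 0" using E1(3)[of "fst p"] E1(3)[of "snd p"] by (simp add: prod_eq_iff)
  qed simp
  show "card ((\<lambda>e. (e, 0)) ` E \<union> (\<lambda>e. (0, e)) ` E) = 2 * card E" if "finite E"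
  proof -
    have "(\<lambda>e. (e, 0)) ` E \<inter> (\<lambda>e. (0, e)) ` E = {}" using E1(1)[of 0] by auto
    then show ?thesis
      using that by (subst card_Un_disjoint) (auto simp: card_image inj_on_def)
  qed
qed

text \<open>Counterpart of \<open>orthonormal_basis_double\<close>: in finite dimension both produce
  bases of the same space, with 2 |E| and 2 |F| elements, which forces |E| = |F|.\<close>

lemma orthonormal_basis_lagrangian:
  fixes U :: "'g::{real_inner, complete_space} \<Rightarrow> 'g"
  assumes U: "bounded_linear U" "\<And>x y. U x \<bullet> y = - (x \<bullet> U y)" "\<And>x. U (U x) = - x"
    and S: "subspace S" "\<And>x y. x \<in> S \<Longrightarrow> y \<in> S \<Longrightarrow> x \<bullet> U y = 0" "\<And>z. \<exists>x\<in>S. \<exists>y\<in>S. z = x + U y"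
    and F: "orthonormal_basis S F"
  shows "orthonormal_basis UNIV (F \<union> U ` F)" and "finite F \<Longrightarrow> card (F \<union> U ` F) = 2 * card F"
proof -
  have F1: "\<And>e. e \<in> F \<Longrightarrow> norm e = 1" "\<And>e f. e \<in> F \<Longrightarrow> f \<in> F \<Longrightarrow> e \<noteq> f \<Longrightarrow> e \<bullet> f = 0"
    "\<And>x. x \<in> S \<Longrightarrow> (\<And>e. e \<in> F \<Longrightarrow> x \<bullet> e = 0) \<Longrightarrow> x = 0" and FS: "F \<subseteq> S"
    using F by (auto simp: orthonormal_basis_def pairwise_def orthogonal_def)
  have UU: "U x \<bullet> U y = x \<bullet> y" for x y by (simp add: U(2,3))
  have FU: "e \<bullet> U f = 0" "U f \<bullet> e = 0" if "e \<in> F" "f \<in> F" for e f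
    using S(2)[of e f] that FS by (auto simp: inner_commute)
  show "orthonormal_basis UNIV (F \<union> U ` F)"
    unfolding orthonormal_basis_def
  proof (intro conjI ballI impI)
    show "pairwise orthogonal (F \<union> U ` F)"
      using F1(2) by (auto simp: pairwise_def orthogonal_def FU UU; blast)
    show "norm p = 1" if "p \<in> F \<union> U ` F" for p
      using that F1(1) UU by (auto simp: norm_eq_1)
    fix p assume p: "\<forall>e\<in>F \<union> U ` F. p \<bullet> e = 0"
    obtain x y where xy: "x \<in> S" "y \<in> S" "p = x + U y" using S(3) by blast
    have "x \<bullet> e = 0" if "e \<in> F" for e
    proof -
      have "p \<bullet> e = 0" using p that by blast
      moreover have "U y \<bullet> e = 0" using S(2) xy FS that by (metis inner_commute subsetD)
      ultimately show ?thesis by (simp add: xy(3) inner_add_left)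
    qed
    moreover have "y \<bullet> e = 0" if "e \<in> F" for e
    proof -
      have "p \<bullet> U e = 0" using p that by blast
      moreover have "x \<bullet> U e = 0" using S(2) xy FS that by blast
      ultimately show ?thesis by (simp add: xy(3) inner_add_left UU)
    qed
    ultimately have "x = 0" "y = 0" using F1(3) xy by blast+
    then show "p = 0" using xy(3) linear_0[OF bounded_linear.linear[OF U(1)]] by simp
  qed simp
  show "card (F \<union> U ` F) = 2 * card F" if "finite F"
  proof -
    have "inj_on U F" by (rule inj_onI) (metis U(3) minus_equation_iff)
    moreover have "F \<inter> U ` F = {}"
    proof -
      have False if "e \<in> F" "f \<in> F" "e = U f" for e f
        using F1(1)[OF that(1)] FU(1)[OF that(1,2)] that(3) by simp
      then show ?thesis by blast
    qed
    ultimately show ?thesis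
      using that by (subst card_Un_disjoint) (auto simp: card_image)
  qed
qed

text \<open>Only the cardinalities of orthonormal bases of \<open>'a\<close> and of \<open>S\<close>
  have to agree. Finite ones agree by comparing the doubled bases; infinite ones are countable by
  separability.\<close>

lemma exists_isometry_onto_lagrangian:
  fixes U :: "'a::{real_inner, complete_space} \<times> 'a \<Rightarrow> 'a \<times> 'a"
  assumes sep: "separable_space (euclidean :: 'a topology)"
    and U: "bounded_linear U" "\<And>x y. U x \<bullet> y = - (x \<bullet> U y)" "\<And>x. U (U x) = - x"
    and S: "subspace S" "closed S" "\<And>x y. x \<in> S \<Longrightarrow> y \<in> S \<Longrightarrow> x \<bullet> U y = 0"
      "\<And>z. \<exists>x\<in>S. \<exists>y\<in>S. z = x + U y"
  obtains T :: "'a \<Rightarrow> 'a \<times> 'a"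
    where "bounded_linear T" "\<And>x y. T x \<bullet> T y = x \<bullet> y" "range T = S"
proof -
  obtain E :: "'a set" where E: "orthonormal_basis UNIV E"
    using exists_orthonormal_basis[OF subspace_UNIV] by blast
  obtain F where F: "orthonormal_basis S F" using exists_orthonormal_basis[OF S(1)] by blast
  define E' where "E' = (\<lambda>e::'a. (e, 0::'a)) ` E \<union> (\<lambda>e. (0, e)) ` E"
  define F' where "F' = F \<union> U ` F"
  have E': "orthonormal_basis UNIV E'" "finite E \<Longrightarrow> card E' = 2 * card E"
    unfolding E'_def using orthonormal_basis_double[OF E] by blast+
  have F': "orthonormal_basis UNIV F'" "finite F \<Longrightarrow> card F' = 2 * card F"
    unfolding F'_def using orthonormal_basis_lagrangian[OF U S(1,3,4) F] by blast+
  have finE: "finite E' \<longleftrightarrow> finite E"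
    unfolding E'_def by (auto dest!: finite_imageD simp: inj_on_def)
  have finF: "finite F' \<longleftrightarrow> finite F" by (auto simp: F'_def)
  note EF = orthonormal_bases_finite_card[OF subspace_UNIV E'(1) F'(1)]
    and FE = orthonormal_bases_finite_card[OF subspace_UNIV F'(1) E'(1)]
  have "\<exists>b. bij_betw b E F"
  proof (cases "finite E")
    case True
    then have "finite F" using FE finE finF by simp
    moreover have "card E = card F" using EF FE E'(2) F'(2) finE finF True \<open>finite F\<close> by fastforce
    ultimately show ?thesis using True finite_same_card_bij by blast
  next
    case False
    then have "infinite F" using EF finE finF by blast
    obtain D :: "('a \<times> 'a) set" where D: "countable D" "closure D = UNIV"
      using exists_dense_countable_prod[OF sep] .
    have "countable F" by (rule countable_orthonormal_basis[OF D F])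
    have "countable E'" by (rule countable_orthonormal_basis[OF D E'(1)])
    then have "countable ((\<lambda>e::'a. (e, 0::'a)) ` E)"
      unfolding E'_def by (rule countable_subset[rotated]) blast
    then have "countable E" by (rule countable_image_inj_on) (simp add: inj_on_def)
    obtain e :: "'a \<Rightarrow> nat" where e: "bij_betw e E UNIV"
      using \<open>countable E\<close> False by (rule countableE_infinite)
    obtain f :: "'a \<times> 'a \<Rightarrow> nat" where f: "bij_betw f F UNIV"
      using \<open>countable F\<close> \<open>infinite F\<close> by (rule countableE_infinite)
    show ?thesis using bij_betw_trans[OF e bij_betw_inv_into[OF f]] by blast
  qed
  then obtain b where "bij_betw b E F" by blast
  from exists_isometry_onto[OF S(1,2) E F this] that show thesis by metis
qed

section \<open>Polar decomposition of skew operators and Williamson's theorem\<close>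

text \<open>\<open>C\<close> is the square root of -B^2, which is B^T B by skewness, and U = B C^-1.
  As \<open>B\<close> commutes with -B^2 it commutes with \<open>C\<close>, whence U^2 = B^2 C^-2 =
  -1.\<close>

lemma skew_polar_decomposition:
  fixes B :: "'g::{real_inner, complete_space} \<Rightarrow> 'g"
  assumes B: "bounded_invertible B" "\<And>x y. B x \<bullet> y = - (x \<bullet> B y)"
  obtains C U where "positive_invertible C" "bounded_linear U" "\<And>x y. U x \<bullet> y = - (x \<bullet> U y)"
    "\<And>x. U (U x) = - x" "\<And>x. U (C x) = C (U x)" "\<And>x. B x = U (C x)"
proof -
  obtain S where S: "bounded_linear B" "bounded_linear S" "\<And>x. S (B x) = x"
    by (rule bounded_invertibleE[OF B(1)]) (rule that)
  note lB = bounded_linear.linear[OF S(1)]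
  obtain K where K: "K > 0" "\<And>x. norm (S x) \<le> norm x * K"
    using bounded_linear.pos_bounded[OF S(2)] by blast
  have "positive_invertible (\<lambda>x. - B (B x))"
  proof (rule positive_invertibleI)
    show "bounded_linear (\<lambda>x. - B (B x))"
      by (intro bounded_linear_minus bounded_linear_compose[OF S(1)] S(1))
    show "symmetric_operator (\<lambda>x. - B (B x))" by (simp add: symmetric_operator_def B(2))
    show "1 / K\<^sup>2 > 0" using K by simp
    show "1 / K\<^sup>2 * (x \<bullet> x) \<le> x \<bullet> - B (B x)" for x
    proof -
      have "x \<bullet> x = (norm (S (B x)))\<^sup>2" by (simp add: S(3) power2_norm_eq_inner)
      also have "\<dots> \<le> (norm (B x) * K)\<^sup>2" by (rule power_mono[OF K(2)]) simp
      also have "\<dots> = K\<^sup>2 * (x \<bullet> - B (B x))"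
        by (simp add: power_mult_distrib power2_norm_eq_inner B(2))
      finally show ?thesis using K by (simp add: field_simps)
    qed
  qed
  then obtain C where C: "positive_invertible C" "\<And>x. C (C x) = - B (B x)"
    "\<forall>Z. bounded_linear Z \<longrightarrow> (\<forall>x. Z (- B (B x)) = - B (B (Z x))) \<longrightarrow> (\<forall>x. Z (C x) = C (Z x))"
    by (rule positive_invertible_sqrt) (rule that)
  have BC: "B (C x) = C (B x)" for x
    using C(3)[rule_format, OF S(1)] by (simp add: linear_neg[OF lB])
  obtain D where D: "positive_invertible D" "\<And>x. D (C x) = x" "\<And>x. C (D x) = x"
    by (rule positive_invertible_inverse[OF C(1)]) (rule that)
  have BD: "B (D x) = D (B x)" for x by (metis BC D(2,3))
  note lD = bounded_linear.linear[OF positive_invertible_bounded_linear[OF D(1)]]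
  show thesis
  proof (rule that[OF C(1), of "\<lambda>x. B (D x)"])
    show "bounded_linear (\<lambda>x. B (D x))"
      by (rule bounded_linear_compose[OF S(1) positive_invertible_bounded_linear[OF D(1)]])
    show "B (D x) \<bullet> y = - (x \<bullet> B (D y))" for x y
      by (simp add: B(2) BD symmetric_operatorD[OF positive_invertible_symmetric[OF D(1)]])
    show "B (D (B (D x))) = - x" for x
    proof -
      have "B (D (B (D x))) = B (B (D (D x)))" by (simp only: BD)
      also have "\<dots> = - (C (C (D (D x))))" by (simp add: C(2))
      finally show ?thesis by (simp add: D)
    qed
    show "B (D (C x)) = C (B (D x))" for x by (simp add: D flip: BC)
    show "B x = B (D (C x))" for x by (simp add: D)
  qed
qed

text \<open>
  With \<open>R = \<surd>A\<close> and the skew operator \<open>B = R J R = U C\<close>, a Lagrangian subspace of \<open>(U, C)\<close> yields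
  an orthogonal \<open>K\<close> with \<open>K\<^sup>T B K = J (P \<oplus> P)\<close>; then \<open>L = R K (P \<oplus> P)\<^sup>-\<^sup>1\<^sup>/\<^sup>2\<close>.
\<close>

theorem williamson:
  fixes A :: "'a::{real_inner, complete_space} \<times> 'a \<Rightarrow> 'a \<times> 'a"
  assumes sep: "separable_space (euclidean :: 'a topology)" and A: "positive_invertible A"
  obtains P L where "williamson_form A P L"
proof -
  obtain R where R: "positive_invertible R" "\<And>x. R (R x) = A x"
    by (rule positive_invertible_sqrt[OF A]) (rule that)
  note Rs = symmetric_operatorD[OF positive_invertible_symmetric[OF R(1)]]
    and Rinv = R(1)[unfolded positive_invertible_def, THEN conjunct2, THEN conjunct2, THEN conjunct2]
  define B where "B = (\<lambda>x. R (J_op (R x)))"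
  have "bounded_invertible B" unfolding B_def
    by (rule bounded_invertible_comp[OF Rinv bounded_invertible_comp[OF bounded_invertible_J_op Rinv]])
  moreover have "B x \<bullet> y = - (x \<bullet> B y)" for x y by (simp add: B_def Rs inner_J_op)
  ultimately obtain C U where C: "positive_invertible C" and U: "bounded_linear U"
    "\<And>x y. U x \<bullet> y = - (x \<bullet> U y)" "\<And>x. U (U x) = - x" and UC: "\<And>x. U (C x) = C (U x)"
    and B_UC: "\<And>x. B x = U (C x)"
    by (rule skew_polar_decomposition) (rule that)
  note lU = bounded_linear.linear[OF U(1)] and Cbl = positive_invertible_bounded_linear[OF C]
    and Csym = positive_invertible_symmetric[OF C]
  note lC = bounded_linear.linear[OF Cbl]
  obtain S where S: "subspace S" "closed S" and CS: "\<And>x. x \<in> S \<Longrightarrow> C x \<in> S"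
    and lag: "\<And>x y. x \<in> S \<Longrightarrow> y \<in> S \<Longrightarrow> x \<bullet> U y = 0" and dec: "\<And>z. \<exists>x\<in>S. \<exists>y\<in>S. z = x + U y"
    by (rule exists_lagrangian_decomposition[OF U Cbl Csym UC]) (rule that)
  obtain T :: "'a \<Rightarrow> 'a \<times> 'a" where T: "bounded_linear T" "\<And>x y. T x \<bullet> T y = x \<bullet> y" "range T = S"
    by (rule exists_isometry_onto_lagrangian[OF sep U S lag dec]) (assumption+, rule that)
  note lT = bounded_linear.linear[OF T(1)]
  have TS: "T x \<in> S" for x using T(3) by blast
  \<comment> \<open>\<open>P\<close> is the restriction of \<open>C\<close> to \<open>S\<close>,
    transported to \<open>'a\<close> along the isometry \<open>T\<close>.\<close>
  have "\<forall>x. \<exists>p. T p = C (T x)" using T(3) CS[OF TS] by (metis imageE)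
  then obtain P where TP: "\<And>x. T (P x) = C (T x)" by metis
  have formP: "x \<bullet> P y = T x \<bullet> C (T y)" for x y by (simp flip: TP T(2))
  obtain e where e: "e > 0" "\<And>x. e * (x \<bullet> x) \<le> x \<bullet> C x"
    using positive_invertible_coercive[OF C] by blast
  have Plin: "linear P"
    by (rule linearI)
      (simp_all add: vector_eq_ldot[symmetric] formP inner_add_right
        linear_add[OF lT] linear_add[OF lC] linear_scale[OF lT] linear_scale[OF lC])
  have P: "positive_invertible P"
  proof (rule positive_invertibleI[OF _ _ e(1)])
    have nT: "norm (T x) = norm x" for x by (simp add: norm_eq T(2))
    obtain K where K: "\<And>x. norm (C x) \<le> norm x * K" using bounded_linear.bounded[OF Cbl] by blast
    have "norm (P x) \<le> norm x * K" for x using K[of "T x"] by (simp add: nT flip: TP)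
    with Plin show "bounded_linear P"
      by (intro bounded_linear_intro[where K = K]) (simp_all add: linear_add linear_scale)
    show "symmetric_operator P"
      unfolding symmetric_operator_def inner_commute[of "P _"] formP
      using symmetric_operatorD[OF Csym] by (metis inner_commute)
    show "e * (x \<bullet> x) \<le> x \<bullet> P x" for x using e(2)[of "T x"] by (simp add: formP T(2))
  qed
  \<comment> \<open>The minus sign fits the convention J (x, y) = (y, -x): from U^2 = -1, both
    \<open>B (K (x, y))\<close> and \<open>K (J_op (P x, P y))\<close> equal T P y + U T P
    x.\<close>
  define K where "K = (\<lambda>p. T (fst p) - U (T (snd p)))"
  have Klin: "bounded_linear K" unfolding K_def
    by (intro bounded_linear_sub bounded_linear_compose[OF U(1)] bounded_linear_compose[OF T(1)]
      bounded_linear_fst bounded_linear_snd)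
  have lag': "T x \<bullet> U (T y) = 0" "U (T x) \<bullet> T y = 0" for x y
    using lag[OF TS TS] by (auto simp: inner_commute)
  have Kiso: "K p \<bullet> K q = p \<bullet> q" for p q
    by (cases p; cases q)
      (simp add: K_def inner_diff_left inner_diff_right lag' T(2), simp add: U(2,3) T(2))
  have Kn: "norm (K p) = norm p" for p by (simp add: norm_eq Kiso)
  have Ksurj: "surj K"
  proof (rule surjI)
    fix z
    have "\<exists>p. K p = z"
    proof -
      obtain x y where "z = T x + U (T y)" using dec[of z] T(3) by blast
      then have "K (x, - y) = z" by (simp add: K_def linear_neg[OF lT] linear_neg[OF lU])
      then show ?thesis by blast
    qed
    then show "K (SOME p. K p = z) = z" by (rule someI_ex)
  qed
  have Kinv: "bounded_invertible K"
    by (rule bounded_invertibleI[OF Klin Ksurj zero_less_one]) (simp add: Kn)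
  obtain K' where K': "bounded_linear K'" "\<And>x. K' (K x) = x" "\<And>x. K (K' x) = x"
    by (rule bounded_invertibleE[OF Kinv]) (rule that)
  define D where "D = map_prod P P"
  have BK: "B (K p) = K (J_op (D p))" for p
    by (cases p) (simp add: B_UC K_def D_def J_op_simps TP linear_diff[OF lC] linear_diff[OF lU]
      linear_neg[OF lT] linear_neg[OF lU] U(3) linear_neg[OF lC] flip: UC)
  obtain Q where Q: "positive_invertible Q" "\<And>x. Q (Q x) = P x"
    by (rule positive_invertible_sqrt[OF P]) (rule that)
  obtain V where V: "positive_invertible V" "\<And>x. V (Q x) = x" "\<And>x. Q (V x) = x"
    by (rule positive_invertible_inverse[OF Q(1)]) (rule that)
  \<comment> \<open>\<open>V\<close> is the inverse square root of \<open>P\<close>, so sandwiching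
    \<open>P\<close> between two copies of it gives the identity.\<close>
  have VPV: "V (P (V x)) = x" for x by (simp add: V flip: Q(2))
  define W where "W = map_prod V V"
  have Wpos: "positive_invertible W" unfolding W_def by (rule positive_invertible_map_prod[OF V(1)])
  note Winv = Wpos[unfolded positive_invertible_def, THEN conjunct2, THEN conjunct2, THEN conjunct2]
    and Ws = symmetric_operatorD[OF positive_invertible_symmetric[OF Wpos]]
  have WDW: "W (D (W x)) = x" for x by (cases x) (simp add: W_def D_def VPV)
  have JW: "J_op (W x) = W (J_op x)" for x
    unfolding W_def
    by (rule J_op_map_prod[OF bounded_linear.linear[OF positive_invertible_bounded_linear[OF V(1)]]])
  have JD: "J_op (D x) = D (J_op x)" for x
    unfolding D_def by (rule J_op_map_prod[OF Plin])
  \<comment> \<open>\<open>W\<close> is the inverse square root of \<open>D\<close>, and K^T B K = J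
    D. Hence L^T J L = W J D W = J and L D L^T = R K K^T R = A, both through W D W = 1.\<close>
  define L where "L = (\<lambda>x. R (K (W x)))"
  \<comment> \<open>\<open>K\<close> is orthogonal, so its inverse \<open>K'\<close> is also its
    transpose.\<close>
  have L': "adjoint L = (\<lambda>x. W (K' (R x)))"
  proof (rule adjoint_unique, intro allI)
    fix x y
    have "L x \<bullet> y = K (W x) \<bullet> K (K' (R y))" by (simp add: L_def Rs K'(3))
    then show "L x \<bullet> y = x \<bullet> W (K' (R y))" by (simp add: Kiso Ws)
  qed
  have "symplectic L" unfolding symplectic_def
  proof (intro conjI ext)
    show "bounded_invertible L" unfolding L_def
      by (rule bounded_invertible_comp[OF Rinv bounded_invertible_comp[OF Kinv Winv]])
    show "(adjoint L \<circ> J_op \<circ> L) x = J_op x" for x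
    proof -
      have "(adjoint L \<circ> J_op \<circ> L) x = W (K' (B (K (W x))))" unfolding L' by (simp add: L_def B_def)
      then show ?thesis by (simp add: BK K'(2) JD JW WDW)
    qed
  qed
  moreover have "A = L \<circ> map_prod P P \<circ> adjoint L"
    unfolding L' by (rule ext) (simp add: L_def K'(3) R(2) WDW flip: D_def)
  ultimately have "williamson_form A P L" using P by (simp add: williamson_form_def)
  then show thesis by (rule that)
qed

section \<open>The symplectic spectrum is well defined\<close>

lemma bounded_invertible_map_prod_iff:
  assumes T: "bounded_linear T"
  shows "bounded_invertible (map_prod T T) \<longleftrightarrow> bounded_invertible T"
proof
  assume "bounded_invertible (map_prod T T)"
  then obtain M where M: "bounded_linear M" "\<And>p. M (map_prod T T p) = p" "\<And>p. map_prod T T (M p) = p"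
    by (rule bounded_invertibleE) (rule that)
  show "bounded_invertible T"
  proof (rule bounded_invertibleI_inverse[OF T, where S = "\<lambda>x. fst (M (x, 0))"])
    show "bounded_linear (\<lambda>x. fst (M (x, 0)))"
      by (intro bounded_linear_compose[OF bounded_linear_fst] bounded_linear_compose[OF M(1)]
        bounded_linear_Pair bounded_linear_ident bounded_linear_zero)
    show "fst (M (T x, 0)) = x" for x
      using M(2)[of "(x, 0)"] linear_0[OF bounded_linear.linear[OF T]] by simp
    show "T (fst (M (x, 0))) = x" for x
      using M(3)[of "(x, 0)"] by (metis fst_conv fst_map_prod)
  qed
next
  assume "bounded_invertible T"
  then obtain S where S: "bounded_linear S" "\<And>x. S (T x) = x" "\<And>x. T (S x) = x"
    by (rule bounded_invertibleE) (rule that)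
  show "bounded_invertible (map_prod T T)"
    by (rule bounded_invertibleI_inverse[where S = "map_prod S S"])
      (simp_all add: S T bounded_linear_map_prod map_prod.compositionality comp_def map_prod.identity[unfolded id_def])
qed

text \<open>Rewrites L^T J L = J as L^T J = J L^-1, which trades the transpose for the
  inverse.\<close>

lemma symplecticE:
  assumes "symplectic L"
  obtains S where "bounded_linear L" "bounded_linear S" "\<And>x. S (L x) = x" "\<And>x. L (S x) = x"
    "\<And>x. adjoint L (J_op x) = J_op (S x)"
proof -
  have "bounded_invertible L" and L: "\<And>x. adjoint L (J_op (L x)) = J_op x"
    using assms unfolding symplectic_def by (auto simp: fun_eq_iff)
  then obtain S where S: "bounded_linear L" "bounded_linear S" "\<And>x. S (L x) = x" "\<And>x. L (S x) = x"
    using bounded_invertibleE by metis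
  have "adjoint L (J_op x) = J_op (S x)" for x using L[of "S x"] by (simp add: S(4))
  with S show thesis by (rule that)
qed

lemma bounded_invertible_minus_of_coercive:
  fixes P :: "'a::{real_inner, complete_space} \<Rightarrow> 'a"
  assumes P: "positive_invertible P" and m: "\<And>x. m * (x \<bullet> x) \<le> x \<bullet> P x" and c: "c < m"
  shows "bounded_invertible (\<lambda>x. P x - c *\<^sub>R x)"
proof (rule coercive_bounded_invertible)
  show "bounded_linear (\<lambda>x. P x - c *\<^sub>R x)"
    by (intro bounded_linear_sub bounded_linear_scaleR_right positive_invertible_bounded_linear[OF P])
  show "symmetric_operator (\<lambda>x. P x - c *\<^sub>R x)"
    using positive_invertible_symmetric[OF P]
    by (simp add: symmetric_operator_def inner_diff_left inner_diff_right)
  show "m - c > 0" using c by simp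
  show "(m - c) * (x \<bullet> x) \<le> x \<bullet> (P x - c *\<^sub>R x)" for x
    using m[of x] by (simp add: inner_diff_right left_diff_distrib)
qed

text \<open>
  Since \<open>A J = L (P \<oplus> P) J L\<^sup>-\<^sup>1\<close>, the operator \<open>(A J)\<^sup>2\<close> is similar to \<open>-(P \<oplus> P)\<^sup>2\<close>; hence the
  spectrum of \<open>P\<close> can be read off from \<open>A\<close> alone.
\<close>

lemma spectrum_williamson_form:
  fixes A :: "'a::{real_inner, complete_space} \<times> 'a \<Rightarrow> 'a \<times> 'a"
  assumes W: "williamson_form A P L"
  shows "spectrum P =
    {c. 0 < c \<and> \<not> bounded_invertible (\<lambda>x. A (J_op (A (J_op x))) + c\<^sup>2 *\<^sub>R x)}"
proof -
  have P: "positive_invertible P" and "symplectic L" and A: "\<And>x. A x = L (map_prod P P (adjoint L x))"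
    using W by (auto simp: williamson_form_def)
  then obtain S where L: "bounded_linear L" and S: "bounded_linear S" "\<And>x. S (L x) = x" "\<And>x. L (S x) = x"
    "\<And>x. adjoint L (J_op x) = J_op (S x)" by (metis symplecticE)
  note Pbl = positive_invertible_bounded_linear[OF P]
  have Linv: "bounded_invertible L" and Sinv: "bounded_invertible S"
    using bounded_invertibleI_inverse L S by metis+
  define D where "D = map_prod P P"
  have D: "positive_invertible D" unfolding D_def by (rule positive_invertible_map_prod[OF P])
  note lD = bounded_linear.linear[OF positive_invertible_bounded_linear[OF D]]
  note lL = bounded_linear.linear[OF L]
  have JD: "J_op (D x) = D (J_op x)" for x
    unfolding D_def by (rule J_op_map_prod[OF bounded_linear.linear[OF Pbl]])
  have AJ: "A (J_op x) = L (D (J_op (S x)))" for x by (simp add: A S(4) D_def)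
  have AJAJ: "A (J_op (A (J_op x))) = - L (D (D (S x)))" for x
    by (simp add: AJ S(2) JD linear_neg[OF lD] linear_neg[OF lL])
  obtain e where e: "e > 0" "\<And>x. e * (x \<bullet> x) \<le> x \<bullet> P x"
    using positive_invertible_coercive[OF P] by blast
  obtain e' where e': "e' > 0" "\<And>x. e' * (x \<bullet> x) \<le> x \<bullet> D x"
    using positive_invertible_coercive[OF D] by blast
  have main: "bounded_invertible (\<lambda>x. P x - c *\<^sub>R x) \<longleftrightarrow>
      bounded_invertible (\<lambda>x. A (J_op (A (J_op x))) + c\<^sup>2 *\<^sub>R x)" if c: "0 < c" for c
  proof -
    \<comment> \<open>Factor D^2 - c^2 as (D + c) (D - c). The factor D + c is invertible because D
      is positive and c > 0, so invertibility of the product is decided by D - c.\<close>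
    define T where "T x = D x - c *\<^sub>R x" for x
    define T' where "T' x = D x + c *\<^sub>R x" for x
    have "bounded_invertible (\<lambda>x. D x - (- c) *\<^sub>R x)"
      using c e'(1) by (intro bounded_invertible_minus_of_coercive[OF D e'(2)]) simp
    then have T': "bounded_invertible T'" by (simp add: T'_def[abs_def])
    then obtain V where V: "bounded_linear T'" "bounded_linear V" "\<And>x. V (T' x) = x" "\<And>x. T' (V x) = x"
      by (rule bounded_invertibleE) (rule that)
    have Vinv: "bounded_invertible V" by (rule bounded_invertibleI_inverse[OF V(2,1,4,3)])
    have F: "A (J_op (A (J_op x))) + c\<^sup>2 *\<^sub>R x = (- 1) *\<^sub>R L (T' (T (S x)))" for x
    proof -
      have "T' (T y) = D (D y) - c\<^sup>2 *\<^sub>R y" for y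
        by (simp add: T_def T'_def linear_diff[OF lD] linear_scale[OF lD] power2_eq_square algebra_simps)
      then show ?thesis by (simp add: AJAJ linear_diff[OF lL] linear_scale[OF lL] S(3))
    qed
    have TF: "T y = (- 1) *\<^sub>R V (S (A (J_op (A (J_op (L y)))) + c\<^sup>2 *\<^sub>R L y))" for y
      unfolding F by (simp add: linear_neg[OF bounded_linear.linear[OF S(1)]]
        linear_neg[OF bounded_linear.linear[OF V(2)]] S(2) V(3))
    have "T = map_prod (\<lambda>x. P x - c *\<^sub>R x) (\<lambda>x. P x - c *\<^sub>R x)"
      by (auto simp: T_def D_def fun_eq_iff)
    then have "bounded_invertible (\<lambda>x. P x - c *\<^sub>R x) \<longleftrightarrow> bounded_invertible T"
      using bounded_invertible_map_prod_iff[of "\<lambda>x. P x - c *\<^sub>R x"] Pbl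
      by (simp add: bounded_linear_sub bounded_linear_scaleR_right)
    also have "\<dots> \<longleftrightarrow> bounded_invertible (\<lambda>x. A (J_op (A (J_op x))) + c\<^sup>2 *\<^sub>R x)"
    proof
      assume T: "bounded_invertible T"
      have "bounded_invertible (\<lambda>x. (- 1) *\<^sub>R L (T' (T (S x))))"
        by (rule bounded_invertible_scaleR[OF bounded_invertible_comp[OF Linv
          bounded_invertible_comp[OF T' bounded_invertible_comp[OF T Sinv]]]]) simp
      then show "bounded_invertible (\<lambda>x. A (J_op (A (J_op x))) + c\<^sup>2 *\<^sub>R x)" unfolding F .
    next
      assume "bounded_invertible (\<lambda>x. A (J_op (A (J_op x))) + c\<^sup>2 *\<^sub>R x)"
      from bounded_invertible_scaleR[OF bounded_invertible_comp[OF Vinv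
          bounded_invertible_comp[OF Sinv bounded_invertible_comp[OF this Linv]]], of "- 1"]
      show "bounded_invertible T" by (simp only: flip: TF)
    qed
    finally show ?thesis .
  qed
  \<comment> \<open>\<open>c\<^sup>2\<close> does not see the sign of \<open>c\<close>; positivity
    of the spectrum makes the restriction to \<open>0 < c\<close> harmless.\<close>
  have "0 < c" if "c \<in> spectrum P" for c
    using bounded_invertible_minus_of_coercive[OF P e(2), of c] e(1) that
    by (force simp: spectrum_def)
  with main show ?thesis by (auto simp: spectrum_def)
qed

text \<open>The description in \<open>spectrum_williamson_form\<close> mentions only
  \<open>A\<close>, so all Williamson forms of \<open>A\<close> give the same set and the definite
  description is justified.\<close>

lemma symplectic_spectrum_eq:
  fixes A :: "'a::{real_inner, complete_space} \<times> 'a \<Rightarrow> 'a \<times> 'a"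
  assumes W: "williamson_form A P L"
  shows "symplectic_spectrum A = spectrum P"
  unfolding symplectic_spectrum_def
proof (rule the_equality)
  show "\<exists>P' L. williamson_form A P' L \<and> spectrum P = spectrum P'" using W by blast
  show "S = spectrum P" if "\<exists>P L. williamson_form A P L \<and> S = spectrum P" for S
    using that spectrum_williamson_form[OF W] spectrum_williamson_form by blast
qed

section \<open>Invariance of the symplectic numerical range\<close>

text \<open>The transpose of a symplectic map is symplectic: M^T J = J M^-1 gives J M^T = M^-1 J,
  and M^-1 cancels against M^T across the inner product.\<close>

lemma symplectic_adjoint_preserves_form:
  fixes M :: "'a::{real_inner, complete_space} \<times> 'a \<Rightarrow> 'a \<times> 'a"
  assumes M: "symplectic M"
  shows "adjoint M u \<bullet> J_op (adjoint M v) = u \<bullet> J_op v"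
proof -
  obtain S where S: "bounded_linear M" "\<And>x. S (M x) = x" "\<And>x. M (S x) = x"
    "\<And>x. adjoint M (J_op x) = J_op (S x)" using symplecticE[OF M] by metis
  have "adjoint M v = - J_op (S (J_op v))"
    using S(4)[of "- J_op v"] bounded_linear.linear[OF bounded_linear_adjoint[OF S(1)]]
    using S(4)[of "J_op v"] by (simp add: linear_neg) (metis add.inverse_inverse)
  then have "J_op (adjoint M v) = S (J_op v)" by simp
  then show ?thesis using inner_adjoint[OF S(1), of "S (J_op v)" u] S(3) by (simp add: inner_commute)
qed

text \<open>Substituting M^T u, M^T v for u, v permutes the admissible pairs; the transpose of the
  inverse of \<open>M\<close> shows that every pair is reached.\<close>

lemma symplectic_numerical_range_congruence:
  fixes M :: "'a::{real_inner, complete_space} \<times> 'a \<Rightarrow> 'a \<times> 'a"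
  assumes M: "symplectic M"
  shows "symplectic_numerical_range (M \<circ> A \<circ> adjoint M) = symplectic_numerical_range A"
proof -
  obtain S where S: "bounded_linear M" "bounded_linear S" "\<And>x. S (M x) = x" "\<And>x. M (S x) = x"
    using symplecticE[OF M] by metis
  note adj = inner_adjoint[OF S(1)] and adjS = inner_adjoint[OF S(2)]
  have form: "u \<bullet> (M \<circ> A \<circ> adjoint M) u = adjoint M u \<bullet> A (adjoint M u)" for u
    by (simp add: adj inner_commute[of u])  (simp add: inner_commute)
  have surj: "adjoint M (adjoint S u) = u" for u
    by (subst vector_eq_ldot[symmetric]) (simp add: S(3) flip: adj adjS)
  note J = symplectic_adjoint_preserves_form[OF M]
  show ?thesis unfolding symplectic_numerical_range_def form
  proof (intro set_eqI iffI)
    fix r assume "r \<in> {(adjoint M u \<bullet> A (adjoint M u) + adjoint M v \<bullet> A (adjoint M v)) / 2 | u v. u \<bullet> J_op v = 1}"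
    then obtain u v where "r = (adjoint M u \<bullet> A (adjoint M u) + adjoint M v \<bullet> A (adjoint M v)) / 2"
      "adjoint M u \<bullet> J_op (adjoint M v) = 1" using J by auto
    then show "r \<in> {(u \<bullet> A u + v \<bullet> A v) / 2 | u v. u \<bullet> J_op v = 1}" by blast
  next
    fix r assume "r \<in> {(u \<bullet> A u + v \<bullet> A v) / 2 | u v. u \<bullet> J_op v = 1}"
    then obtain u v where uv: "r = (u \<bullet> A u + v \<bullet> A v) / 2" "u \<bullet> J_op v = 1" by blast
    have "adjoint S u \<bullet> J_op (adjoint S v) = 1" using J[of "adjoint S u" "adjoint S v"] uv(2) by (simp add: surj)
    with uv(1) show "r \<in> {(adjoint M u \<bullet> A (adjoint M u) + adjoint M v \<bullet> A (adjoint M v)) / 2 | u v. u \<bullet> J_op v = 1}"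
      by (intro CollectI exI[of _ "adjoint S u"] exI[of _ "adjoint S v"]) (simp add: surj)
  qed
qed

section \<open>Bottom of the spectrum and the numerical range of P (+) P\<close>

text \<open>\<open>m\<close> is the infimum of the form on the unit sphere, which is nonempty by
  \<open>nz\<close>. Were P - m invertible, its nonnegative form would be coercive, contradicting
  the infimum.\<close>

lemma spectrum_bottom:
  fixes P :: "'a::{real_inner, complete_space} \<Rightarrow> 'a"
  assumes P: "positive_invertible P" and nz: "\<exists>x::'a. x \<noteq> 0"
  obtains m where "m \<in> spectrum P" "\<And>c. c \<in> spectrum P \<Longrightarrow> m \<le> c" "\<And>x. m * (x \<bullet> x) \<le> x \<bullet> P x"
    "\<And>t. m < t \<Longrightarrow> \<exists>x. x \<bullet> x = 1 \<and> x \<bullet> P x < t"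
proof -
  note lP = bounded_linear.linear[OF positive_invertible_bounded_linear[OF P]]
  define N where "N = (\<lambda>x. x \<bullet> P x) ` {x. x \<bullet> x = 1}"
  define m where "m = Inf N"
  obtain z :: 'a where "z \<noteq> 0" using nz by blast
  then have "((1 / norm z) *\<^sub>R z) \<bullet> ((1 / norm z) *\<^sub>R z) = 1"
    by (simp add: dot_square_norm power2_eq_square)
  then have ne: "N \<noteq> {}" unfolding N_def by blast
  have bdd: "bdd_below N"
    by (rule bdd_belowI[of _ 0]) (auto simp: N_def positive_invertible_form_nonneg[OF P])
  have low: "m * (x \<bullet> x) \<le> x \<bullet> P x" for x
  proof (cases "x = 0")
    case False
    define y where "y = (1 / norm x) *\<^sub>R x"
    have "y \<bullet> y = 1" using False by (simp add: y_def dot_square_norm power2_eq_square)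
    then have "m \<le> y \<bullet> P y" unfolding m_def by (intro cInf_lower bdd) (auto simp: N_def)
    also have "\<dots> = (x \<bullet> P x) / (x \<bullet> x)"
      by (simp add: y_def linear_scale[OF lP] dot_square_norm power2_eq_square)
    finally show ?thesis using False by (simp add: field_simps)
  qed simp
  have approx: "\<exists>x. x \<bullet> x = 1 \<and> x \<bullet> P x < t" if "m < t" for t
    using cInf_lessD[OF ne, of t] that unfolding m_def N_def by auto
  have "m \<in> spectrum P"
  proof (rule ccontr)
    assume "m \<notin> spectrum P"
    then have inv: "bounded_invertible (\<lambda>x. P x - m *\<^sub>R x)" by (simp add: spectrum_def)
    have sym: "symmetric_operator (\<lambda>x. P x - m *\<^sub>R x)"
      using positive_invertible_symmetric[OF P]
      by (simp add: symmetric_operator_def inner_diff_left inner_diff_right)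
    have "0 \<le> x \<bullet> (P x - m *\<^sub>R x)" for x using low[of x] by (simp add: inner_diff_right)
    then obtain e where e: "e > 0" "\<And>x. e * (x \<bullet> x) \<le> x \<bullet> (P x - m *\<^sub>R x)"
      using invertible_nonneg_coercive[OF inv sym] by blast
    obtain x where x: "x \<bullet> x = 1" "x \<bullet> P x < m + e" using approx[of "m + e"] e(1) by auto
    then show False using e(2)[of x] by (simp add: inner_diff_right)
  qed
  moreover have "m \<le> c" if "c \<in> spectrum P" for c
    using bounded_invertible_minus_of_coercive[OF P low, of c] that by (force simp: spectrum_def)
  ultimately show thesis using that low approx by blast
qed

lemma inner_le_half_sum_squares:
  fixes u v :: "'a::real_inner"
  shows "u \<bullet> v \<le> (u \<bullet> u + v \<bullet> v) / 2"
proof -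
  have "2 * (u \<bullet> v) \<le> 2 * norm u * norm v" by (simp add: norm_cauchy_schwarz)
  also have "\<dots> \<le> (norm u)\<^sup>2 + (norm v)\<^sup>2" by (rule sum_squares_bound)
  finally show ?thesis by (simp add: power2_norm_eq_inner)
qed

lemma numerical_range_double_ge:
  fixes P :: "'a::real_inner \<Rightarrow> 'a"
  assumes m: "0 \<le> m" "\<And>x. m * (x \<bullet> x) \<le> x \<bullet> P x"
    and r: "r \<in> symplectic_numerical_range (map_prod P P)"
  shows "m \<le> r"
proof -
  obtain u v where uv: "u \<bullet> J_op v = 1" "r = (u \<bullet> map_prod P P u + v \<bullet> map_prod P P v) / 2"
    using r by (auto simp: symplectic_numerical_range_def)
  have D: "m * (x \<bullet> x) \<le> x \<bullet> map_prod P P x" for x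
    using add_mono[OF m(2)[of "fst x"] m(2)[of "snd x"]] by (cases x) (simp add: distrib_left)
  have "1 \<le> (u \<bullet> u + v \<bullet> v) / 2"
    using inner_le_half_sum_squares[of u "J_op v"] uv(1) by simp
  then have "m * 1 \<le> m * ((u \<bullet> u + v \<bullet> v) / 2)" using m(1) by (rule mult_left_mono)
  also have "\<dots> \<le> r" using D[of u] D[of v] by (simp add: uv(2) distrib_left)
  finally show ?thesis by simp
qed

text \<open>
  For a unit vector \<open>x\<close> and \<open>a b = 1\<close>, the pair \<open>u = (a x, 0)\<close>, \<open>v = (0, b x)\<close> has value
  \<open>(a\<^sup>2 + b\<^sup>2) / 2\<close> times \<open>\<langle>x, P x\<rangle>\<close>.
\<close>

lemma numerical_range_double_mem:
  fixes P :: "'a::real_inner \<Rightarrow> 'a"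
  assumes P: "linear P" and x: "x \<bullet> x = 1" "0 < x \<bullet> P x" "x \<bullet> P x \<le> r"
  shows "r \<in> symplectic_numerical_range (map_prod P P)"
proof -
  define k where "k = r / (x \<bullet> P x)"
  have k: "1 \<le> k" "r = k * (x \<bullet> P x)" using x by (auto simp: k_def)
  \<comment> \<open>Chosen so that p^2 - q^2 = 1 and p^2 + q^2 = k; then p + q and p - q have
    product 1 and mean square k. The bound \<open>1 \<le> k\<close> keeps the radicands
    nonnegative.\<close>
  define p q where "p = sqrt ((k + 1) / 2)" and "q = sqrt ((k - 1) / 2)"
  define a b where "a = p + q" and "b = p - q"
  have pq: "p * p = (k + 1) / 2" "q * q = (k - 1) / 2" using k by (simp_all add: p_def q_def)
  have ab: "a * b = 1" "(a * a + b * b) / 2 = k"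
    using pq by (simp_all add: a_def b_def algebra_simps)
  have "r = ((a *\<^sub>R x, 0) \<bullet> map_prod P P (a *\<^sub>R x, 0) + (0, b *\<^sub>R x) \<bullet> map_prod P P (0, b *\<^sub>R x)) / 2"
    using k(2) by (simp add: linear_scale[OF P] linear_0[OF P] algebra_simps flip: ab(2))
  moreover have "(a *\<^sub>R x, 0) \<bullet> J_op (0, b *\<^sub>R x) = 1" using ab(1) x(1) by (simp add: J_op_simps mult.commute)
  ultimately show ?thesis unfolding symplectic_numerical_range_def by blast
qed

section \<open>Finite dimension\<close>

text \<open>Without an eigenvector, P - c is injective, so by counting it carries a finite
  orthonormal basis to a spanning set and is surjective. Expanding in the basis bounds the
  inverse.\<close>

lemma spectrum_eigenvector_finite_dim:
  fixes P :: "'a::real_inner \<Rightarrow> 'a"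
  assumes P: "bounded_linear P" and B: "finite B" "span B = (UNIV :: 'a set)"
    and c: "c \<in> spectrum P"
  obtains x where "x \<noteq> 0" "P x = c *\<^sub>R x"
proof (rule ccontr)
  assume "\<not> thesis"
  then have noeig: "\<And>x. P x = c *\<^sub>R x \<Longrightarrow> x = 0" using that by blast
  define T where "T = (\<lambda>x. P x - c *\<^sub>R x)"
  have T: "bounded_linear T"
    unfolding T_def by (intro bounded_linear_sub bounded_linear_scaleR_right P)
  note lT = bounded_linear.linear[OF T]
  have inj: "inj T" using noeig by (simp add: linear_inj_iff_eq_0[OF lT]) (simp add: T_def)
  obtain E :: "'a set" where E: "orthonormal_basis UNIV E"
    using exists_orthonormal_basis[OF subspace_UNIV] by blast
  have fin: "finite E"
    using independent_span_bound[OF B(1) independent_orthonormal_basis[OF E]] B(2) by simp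
  have spanE: "span E = UNIV" using orthonormal_basis_span[OF subspace_UNIV E fin] by simp
  have indep: "independent (T ` E)"
    by (rule linear_independent_injective_image[OF lT independent_orthonormal_basis[OF E]])
      (rule inj_on_subset[OF inj subset_UNIV])
  have card: "card (T ` E) = card E" by (rule card_image) (rule inj_on_subset[OF inj subset_UNIV])
  have "y \<in> span (T ` E)" for y
  proof (rule ccontr)
    assume y: "y \<notin> span (T ` E)"
    \<comment> \<open>Otherwise there would be one more independent vector than \<open>E\<close> has
      elements.\<close>
    have "insert y (T ` E) \<subseteq> span E" by (simp add: spanE)
    then have "card (insert y (T ` E)) \<le> card E"
      using independent_span_bound[OF fin independent_insertI[OF y indep]] by blast
    moreover have "y \<notin> T ` E" by (rule contrapos_nn[OF y span_base])
    ultimately show False using fin card card_insert_disjoint[of "T ` E" y] by simp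
  qed
  moreover have "span (T ` E) = range T" by (simp add: linear_span_image[OF lT] spanE)
  ultimately have surj: "surj T" by blast
  note TS = surj_f_inv_f[OF surj] and ST = inv_f_f[OF inj]
  have lS: "linear (inv T)"
    by (rule linearI; rule inv_f_eq[OF inj]) (simp_all add: linear_add[OF lT] linear_scale[OF lT] TS)
  \<comment> \<open>Bounds the inverse, since coefficients in an orthonormal basis are at most the
    norm; the added 1 keeps it positive when the sum vanishes.\<close>
  define K where "K = (\<Sum>e\<in>E. norm (inv T e)) + 1"
  have K: "0 < K" unfolding K_def by (intro add_nonneg_pos sum_nonneg) auto
  have low: "1 / K * norm x \<le> norm (T x)" for x
  proof -
    let ?y = "T x"
    have "x = inv T (\<Sum>e\<in>E. (?y \<bullet> e) *\<^sub>R e)"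
      by (simp add: orthonormal_basis_expansion[OF subspace_UNIV E fin UNIV_I] ST)
    also have "\<dots> = (\<Sum>e\<in>E. (?y \<bullet> e) *\<^sub>R inv T e)"
      by (simp add: linear_sum[OF lS] linear_scale[OF lS])
    also have "norm \<dots> \<le> (\<Sum>e\<in>E. norm ?y * norm (inv T e))"
    proof (rule sum_norm_le)
      fix e assume "e \<in> E"
      then have "norm e = 1" using E by (simp add: orthonormal_basis_def)
      then have "\<bar>?y \<bullet> e\<bar> \<le> norm ?y" using Cauchy_Schwarz_ineq2[of ?y e] by simp
      then show "norm ((?y \<bullet> e) *\<^sub>R inv T e) \<le> norm ?y * norm (inv T e)"
        by (simp add: mult_right_mono)
    qed
    also have "\<dots> \<le> norm ?y * K" by (simp add: K_def distrib_left flip: sum_distrib_left)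
    finally show ?thesis using K by (simp add: field_simps)
  qed
  have "0 < 1 / K" using K by simp
  then have "bounded_invertible T" by (rule bounded_invertibleI[OF T surj _ low])
  moreover have "\<not> bounded_invertible T" using c unfolding spectrum_def T_def by blast
  ultimately show False by blast
qed

text \<open>Eigenvectors for different eigenvalues are orthogonal, hence independent. Finiteness is
  what gives \<open>Min\<close> of the spectrum its meaning.\<close>

lemma finite_spectrum_finite_dim:
  fixes P :: "'a::real_inner \<Rightarrow> 'a"
  assumes P: "bounded_linear P" "symmetric_operator P" and B: "finite B" "span B = (UNIV :: 'a set)"
  shows "finite (spectrum P)"
proof -
  have "\<forall>c\<in>spectrum P. \<exists>x. x \<noteq> 0 \<and> P x = c *\<^sub>R x"
    by (rule ballI, rule spectrum_eigenvector_finite_dim[OF P(1) B]) (assumption, intro exI conjI)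
  then obtain f where f: "\<And>c. c \<in> spectrum P \<Longrightarrow> f c \<noteq> 0" "\<And>c. c \<in> spectrum P \<Longrightarrow> P (f c) = c *\<^sub>R f c"
    by metis
  have orth: "f c \<bullet> f d = 0" if "c \<in> spectrum P" "d \<in> spectrum P" "c \<noteq> d" for c d
    using symmetric_operatorD[OF P(2), of "f c" "f d"] f(2) that by simp
  have "inj_on f (spectrum P)"
    by (rule inj_onI) (metis f(1) inner_eq_zero_iff orth)
  moreover have "independent (f ` spectrum P)"
  proof (rule pairwise_orthogonal_independent)
    show "pairwise orthogonal (f ` spectrum P)"
      unfolding pairwise_def orthogonal_def using orth by blast
    show "0 \<notin> f ` spectrum P" using f(1) by force
  qed
  then have "finite (f ` spectrum P)" using independent_span_bound[OF B(1)] B(2) by blast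
  ultimately show ?thesis by (rule finite_imageD[rotated])
qed

section \<open>The symplectic numerical range theorem\<close>

theorem proposition3p1:
  fixes A :: "'a::{real_inner, complete_space} \<times> 'a \<Rightarrow> 'a \<times> 'a"
  assumes "separable_space (euclidean :: 'a topology)"
    and "positive_invertible A"
  shows "(\<forall>M. symplectic M \<longrightarrow>
            symplectic_numerical_range A = symplectic_numerical_range (M \<circ> A \<circ> adjoint M)) \<and>
         symplectic_spectrum A \<subseteq> closure (symplectic_numerical_range A) \<and>
         ((\<exists>x::'a. x \<noteq> 0) \<longrightarrow>
            closure (symplectic_numerical_range A) = {Inf (symplectic_spectrum A)..}) \<and>
         ((\<exists>x::'a. x \<noteq> 0) \<and> (\<exists>B::'a set. finite B \<and> span B = UNIV) \<longrightarrow>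
            closed (symplectic_numerical_range A) \<and>
            symplectic_numerical_range A = {min_symplectic_eigenvalue A..})"
proof -
  obtain P L where W: "williamson_form A P L" using williamson[OF assms] .
  then have P: "positive_invertible P" and L: "symplectic L" and A: "A = L \<circ> map_prod P P \<circ> adjoint L"
    by (auto simp: williamson_form_def)
  note lP = bounded_linear.linear[OF positive_invertible_bounded_linear[OF P]]
  have spec: "symplectic_spectrum A = spectrum P" by (rule symplectic_spectrum_eq[OF W])
  have range: "symplectic_numerical_range A = symplectic_numerical_range (map_prod P P)"
    unfolding A by (rule symplectic_numerical_range_congruence[OF L])
  let ?W = "symplectic_numerical_range (map_prod P P)"
  show ?thesis
  proof (cases "\<exists>x::'a. x \<noteq> 0")
    \<comment> \<open>On the zero space every operator is invertible, so the symplectic spectrum is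
      empty; only invariance and the inclusion have content there.\<close>
    case False
    then have z: "x = 0" for x :: 'a by blast
    have "bounded_invertible (\<lambda>x. P x - c *\<^sub>R x)" for c
    proof (rule bounded_invertibleI_inverse[where S = "\<lambda>x. x"])
      show "bounded_linear (\<lambda>x. P x - c *\<^sub>R x)"
        by (intro bounded_linear_sub bounded_linear_scaleR_right positive_invertible_bounded_linear[OF P])
    qed (use z in \<open>metis bounded_linear_ident\<close>)+
    then have "symplectic_spectrum A = {}" by (simp add: spec spectrum_def)
    with False show ?thesis by (auto simp: symplectic_numerical_range_congruence)
  next
    case True
    obtain m where m: "m \<in> spectrum P" "\<And>c. c \<in> spectrum P \<Longrightarrow> m \<le> c"
      "\<And>x. m * (x \<bullet> x) \<le> x \<bullet> P x" "\<And>t. m < t \<Longrightarrow> \<exists>x. x \<bullet> x = 1 \<and> x \<bullet> P x < t"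
      by (rule spectrum_bottom[OF P True]) (rule that)
    have m_pos: "0 < m" using m(1) spectrum_williamson_form[OF W] by blast
    have pos: "0 < x \<bullet> P x" if "x \<bullet> x = 1" for x
      using m(3)[of x] m_pos that by simp
    have lower: "?W \<subseteq> {m..}"
      using numerical_range_double_ge[OF less_imp_le[OF m_pos] m(3)] by auto
    \<comment> \<open>Strict, because the infimum of the form may fail to be attained; in general
      \<open>m\<close> is only reached in the closure.\<close>
    have upper: "{m<..} \<subseteq> ?W"
    proof
      fix r assume "r \<in> {m<..}"
      then obtain x where "x \<bullet> x = 1" "x \<bullet> P x < r" using m(4) by auto
      then show "r \<in> ?W" using pos by (intro numerical_range_double_mem[OF lP, of x]) auto
    qed
    have cl: "closure ?W = {m..}"
    proof
      show "closure ?W \<subseteq> {m..}" by (rule closure_minimal[OF lower]) simp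
      show "{m..} \<subseteq> closure ?W" using closure_mono[OF upper] by simp
    qed
    have Inf: "Inf (spectrum P) = m" by (rule cInf_eq_minimum[OF m(1,2)])
    have fin_dim: "?W = {m..} \<and> Min (spectrum P) = m"
      if "finite B" "span B = UNIV" for B :: "'a set"
    proof
      obtain x where x: "x \<noteq> 0" "P x = m *\<^sub>R x"
        by (rule spectrum_eigenvector_finite_dim[OF positive_invertible_bounded_linear[OF P] \<open>finite B\<close>
          \<open>span B = UNIV\<close> m(1)]) (rule that)
      define y where "y = (1 / norm x) *\<^sub>R x"
      have y: "y \<bullet> y = 1" "P y = m *\<^sub>R y"
        using x by (simp_all add: y_def linear_scale[OF lP] dot_square_norm power2_eq_square)
      have "m \<in> ?W" using y m_pos by (intro numerical_range_double_mem[OF lP y(1)]) auto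
      moreover have "{m..} = insert m {m<..}" by auto
      ultimately show "?W = {m..}" using lower upper by (intro subset_antisym) simp_all
      have "finite (spectrum P)"
        by (rule finite_spectrum_finite_dim[OF positive_invertible_bounded_linear[OF P]
          positive_invertible_symmetric[OF P] \<open>finite B\<close> \<open>span B = UNIV\<close>])
      then show "Min (spectrum P) = m" using m(1,2) by (intro Min_eqI) auto
    qed
    show ?thesis
      unfolding min_symplectic_eigenvalue_def spec range cl Inf
    proof (intro conjI impI allI)
      show "?W = symplectic_numerical_range (M \<circ> A \<circ> adjoint M)" if "symplectic M" for M
        using symplectic_numerical_range_congruence[OF that] range by simp
      show "spectrum P \<subseteq> {m..}" using m(2) by auto
    qed (use fin_dim in auto)
  qed
qed

end
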